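(* Suppose that $\mathcal{A} \in \mathbf{S}$ has no fixed point and let $H$ be a subgroup of $\mathrm{Aut}(\mathcal{A})$ without any fixed point. Then $\mathbf{S}(\mathcal{A}, H) = \bigcup_{n \ge 1} \mathbf{S}_n(\mathcal{A}, H)$ has a zero-one law: for every first-order sentence $\varphi$, the proportion of $\mathcal{M}\in\mathbf{S}_n(\mathcal{A},H)$ satisfying $\varphi$ converges to $0$ or to $1$ as $n\to\infty$.
   Context: Fix a finite relational vocabulary with maximal arity at least $2$. $\mathbf{S}_n$ is the set of structures with universe $[n]=\{1,\dots,n\}$, $\mathbf{S}=\bigcup_n\mathbf{S}_n$. A permutation group has no fixed point if no element is fixed by all its members; a structure has no fixed point if its automorphism group has none. For a finite structure $\mathcal{M}$, $\mathrm{Spt}^*(\mathcal{M})$ is the set of elements moved by some automorphism; for a union $X$ of orbits of a permutation group $K$, $K\restriction X=\{k\restriction X:k\in K\}$. $\mathbf{S}_n(\mathcal{A},H)$ is the set of $\mathcal{M}\in\mathbf{S}_n$ for which there is an embedding $f:\mathcal{A}\to\mathcal{M}$ with image $\mathrm{Spt}^*(\mathcal{M})$ such that $\{f\sigma f^{-1}:\sigma\in H\}$ is a subgroup of $\mathrm{Aut}(\mathcal{M})\restriction\mathrm{Spt}^*(\mathcal{M})$. *)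

theory Defs
  imports Complex_Main "HOL-Algebra.Bij"
begin

section \<open>Finite relational structures\<close>

text \<open>
  A finite relational vocabulary is a finite type \<open>'r\<close> of relation symbols together with an
  arity function \<open>ar\<close>.
\<close>

record ('r, 'a) rstruct =
  universe :: "'a set"
  rel :: "'r \<Rightarrow> 'a list set"

definition is_structure :: "('r \<Rightarrow> nat) \<Rightarrow> ('r, 'a) rstruct \<Rightarrow> bool" where
  "is_structure ar M \<longleftrightarrow>
     (\<forall>R. rel M R \<subseteq> {xs. length xs = ar R \<and> set xs \<subseteq> universe M})"

definition structs_n :: "('r \<Rightarrow> nat) \<Rightarrow> nat \<Rightarrow> ('r, nat) rstruct set" where
  "structs_n ar n = {M. is_structure ar M \<and> universe M = {1..n}}"

definition structs :: "('r \<Rightarrow> nat) \<Rightarrow> ('r, nat) rstruct set" where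
  "structs ar = (\<Union>n\<in>{1..}. structs_n ar n)"

definition embedding ::
  "('r \<Rightarrow> nat) \<Rightarrow> ('r, 'a) rstruct \<Rightarrow> ('r, 'b) rstruct \<Rightarrow> ('a \<Rightarrow> 'b) \<Rightarrow> bool" where
  "embedding ar M N f \<longleftrightarrow>
     f ` universe M \<subseteq> universe N \<and> inj_on f (universe M) \<and>
     (\<forall>R xs. length xs = ar R \<and> set xs \<subseteq> universe M \<longrightarrow>
        (xs \<in> rel M R \<longleftrightarrow> map f xs \<in> rel N R))"


section \<open>Automorphisms, fixed points and support\<close>

text \<open>
  Permutations of a set \<open>X\<close> are elements of \<open>Bij X\<close>, i.e. they are \<open>undefined\<close> outside \<open>X\<close>, so
  that distinct functions are distinct permutations. Composition is that of \<open>BijGroup X\<close>.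
\<close>

definition Aut :: "('r \<Rightarrow> nat) \<Rightarrow> ('r, 'a) rstruct \<Rightarrow> ('a \<Rightarrow> 'a) set" where
  "Aut ar M = {g \<in> Bij (universe M). embedding ar M M g}"

definition perm_group :: "'a set \<Rightarrow> ('a \<Rightarrow> 'a) set \<Rightarrow> ('a \<Rightarrow> 'a) monoid" where
  "perm_group X K = (BijGroup X)\<lparr>carrier := K\<rparr>"

definition no_fixed_point :: "'a set \<Rightarrow> ('a \<Rightarrow> 'a) set \<Rightarrow> bool" where
  "no_fixed_point X K \<longleftrightarrow> \<not> (\<exists>x\<in>X. \<forall>k\<in>K. k x = x)"

definition Spt_star :: "('r \<Rightarrow> nat) \<Rightarrow> ('r, 'a) rstruct \<Rightarrow> 'a set" where
  "Spt_star ar M = {x \<in> universe M. \<exists>g\<in>Aut ar M. g x \<noteq> x}"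

definition restrict_group :: "('a \<Rightarrow> 'a) set \<Rightarrow> 'a set \<Rightarrow> ('a \<Rightarrow> 'a) set" where
  "restrict_group K X = (\<lambda>k. restrict k X) ` K"

definition conj_group :: "('a \<Rightarrow> 'b) \<Rightarrow> 'a set \<Rightarrow> ('a \<Rightarrow> 'a) set \<Rightarrow> ('b \<Rightarrow> 'b) set" where
  "conj_group f X H = (\<lambda>\<sigma>. restrict (f \<circ> \<sigma> \<circ> inv_into X f) (f ` X)) ` H"

definition structs_n_AH ::
  "('r \<Rightarrow> nat) \<Rightarrow> ('r, nat) rstruct \<Rightarrow> (nat \<Rightarrow> nat) set \<Rightarrow> nat \<Rightarrow> ('r, nat) rstruct set" where
  "structs_n_AH ar A H n =
     {M \<in> structs_n ar n.
        \<exists>f. embedding ar A M f \<and> f ` universe A = Spt_star ar M \<and>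
            subgroup (conj_group f (universe A) H)
              (perm_group (Spt_star ar M) (restrict_group (Aut ar M) (Spt_star ar M)))}"


section \<open>First-order logic with equality\<close>

datatype 'r fm =
    Eq nat nat
  | Rel 'r "nat list"
  | Neg "'r fm"
  | And "'r fm" "'r fm"
  | Exists nat "'r fm"

primrec wf_fm :: "('r \<Rightarrow> nat) \<Rightarrow> 'r fm \<Rightarrow> bool" where
  "wf_fm ar (Eq x y) \<longleftrightarrow> True"
| "wf_fm ar (Rel R xs) \<longleftrightarrow> length xs = ar R"
| "wf_fm ar (Neg \<phi>) \<longleftrightarrow> wf_fm ar \<phi>"
| "wf_fm ar (And \<phi> \<psi>) \<longleftrightarrow> wf_fm ar \<phi> \<and> wf_fm ar \<psi>"
| "wf_fm ar (Exists x \<phi>) \<longleftrightarrow> wf_fm ar \<phi>"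

primrec free_vars :: "'r fm \<Rightarrow> nat set" where
  "free_vars (Eq x y) = {x, y}"
| "free_vars (Rel R xs) = set xs"
| "free_vars (Neg \<phi>) = free_vars \<phi>"
| "free_vars (And \<phi> \<psi>) = free_vars \<phi> \<union> free_vars \<psi>"
| "free_vars (Exists x \<phi>) = free_vars \<phi> - {x}"

definition sentence :: "('r \<Rightarrow> nat) \<Rightarrow> 'r fm \<Rightarrow> bool" where
  "sentence ar \<phi> \<longleftrightarrow> wf_fm ar \<phi> \<and> free_vars \<phi> = {}"

primrec sat :: "('r, 'a) rstruct \<Rightarrow> (nat \<Rightarrow> 'a) \<Rightarrow> 'r fm \<Rightarrow> bool" where
  "sat M e (Eq x y) \<longleftrightarrow> e x = e y"
| "sat M e (Rel R xs) \<longleftrightarrow> map e xs \<in> rel M R"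
| "sat M e (Neg \<phi>) \<longleftrightarrow> \<not> sat M e \<phi>"
| "sat M e (And \<phi> \<psi>) \<longleftrightarrow> sat M e \<phi> \<and> sat M e \<psi>"
| "sat M e (Exists x \<phi>) \<longleftrightarrow> (\<exists>a\<in>universe M. sat M (e(x := a)) \<phi>)"

definition models :: "('r, 'a) rstruct \<Rightarrow> 'r fm \<Rightarrow> bool" where
  "models M \<phi> \<longleftrightarrow> (\<forall>e. range e \<subseteq> universe M \<longrightarrow> sat M e \<phi>)"


section \<open>Zero-one laws\<close>

text \<open>
  The class \<open>\<Union>n. K n\<close> is given by its finite layers \<open>K n\<close> of structures with universe \<open>[n]\<close>.
  The quotient is \<open>0\<close> when \<open>K n\<close> is empty; only the layers with large \<open>n\<close> matter.
\<close>

definition proportion :: "('r, nat) rstruct set \<Rightarrow> 'r fm \<Rightarrow> real" where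
  "proportion C \<phi> = real (card {M \<in> C. models M \<phi>}) / real (card C)"

definition zero_one_law :: "('r \<Rightarrow> nat) \<Rightarrow> (nat \<Rightarrow> ('r, nat) rstruct set) \<Rightarrow> bool" where
  "zero_one_law ar K \<longleftrightarrow>
     (\<forall>\<phi>. sentence ar \<phi> \<longrightarrow>
        (\<lambda>n. proportion (K n) \<phi>) \<longlonglongrightarrow> 0 \<or> (\<lambda>n. proportion (K n) \<phi>) \<longlonglongrightarrow> 1)"

end

(*
Let C(f) be the class of structures on [n] in which f embeds A and every f h f^-1 (h in H), extended
by the identity, is an automorphism. Its members correspond to the subsets of a set of orbits of
tuples, so a uniformly random member makes independent choices. Two properties therefore hold in
C(f) with probability tending to 1, uniformly in f:
(1) every H-invariant quantifier-free description of a new point over a bounded set containing the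
image of f is realized, because different candidates depend on disjoint blocks of orbits;
(2) no automorphism moves a point outside the image of f: one that moves exactly the s > 0 points of
T outside forces s (n - m) / 3 choices, m being the size of A, while there are at most n^(2s + m)
such permutations.
By (1) an Ehrenfeucht-Fraisse argument over the image of f shows that almost all members of all C(f)
agree on a given sentence. By (2) almost all members of C(f) have support equal to the image of f and
thus lie in S_n(A,H), which is covered by the C(f). Each such structure lies in at most m^m of the
classes, so exceptions remain negligible in S_n(A,H).
*)
theory Submission
  imports Defs "HOL-Combinatorics.Permutations" "HOL-Real_Asymp.Real_Asymp"
begin

text \<open>The embedding is not determined by a member of S_n(A,H), and the automorphism group may
  restrict to more than the conjugate of H. So independent choices are available only in the
  overlapping classes C(f). Points outside the image of f are fixed by the extended group, so in a
  member of C(f) the description of such a point is necessarily H-invariant. The game must therefore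
  show that a description copied from M to M' is again invariant. It is, because both images are
  indexed by A and the correspondence of indices commutes with H. That the support contains the
  image of f follows from H having no fixed point. The converse inclusion is only probable and rests
  on a symbol of arity at least 2: each moved point forces on average at least (n - m) / 3 choices,
  while naming the point and its value costs only 2 log n bits. Unary symbols would give a bounded
  number of choices per point. Agreement on a sentence is proved across different n as well as
  different f, so that a single structure decides whether the limit is 0 or 1.\<close>

section \<open>Counting\<close>

text \<open>For a uniformly random subset of \<open>W\<close>, the traces on disjoint blocks are
  independent, and each equals its target with probability at least \<open>1 / 2 ^ t\<close>. The
  induction removes one block from \<open>W\<close> at a time.\<close>

lemma card_avoid_blocks:
  fixes Bl Tg :: "'z \<Rightarrow> 'c set"
  assumes "finite Z" "finite W" "disjoint_family_on Bl Z"
    and "\<And>z. z \<in> Z \<Longrightarrow> Bl z \<subseteq> W" "\<And>z. z \<in> Z \<Longrightarrow> card (Bl z) \<le> t"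
    and "\<And>z. z \<in> Z \<Longrightarrow> Tg z \<subseteq> Bl z"
  shows "real (card {S \<in> Pow W. \<forall>z\<in>Z. S \<inter> Bl z \<noteq> Tg z}) \<le> 2 ^ card W * (1 - 1 / 2 ^ t) ^ card Z"
  using assms
proof (induction Z arbitrary: W rule: finite_induct)
  case empty
  then show ?case using card_Pow[of W] by (simp add: Pow_def)
next
  case (insert z Z)
  let ?G = "\<lambda>W Z. {S \<in> Pow W. \<forall>z\<in>Z. S \<inter> Bl z \<noteq> Tg z}"
  let ?W = "W - Bl z"
  have fin: "finite W" "Bl z \<subseteq> W" "finite (Bl z)"
    using insert.prems finite_subset[of "Bl z" W] by auto
  have disj: "Bl y \<inter> Bl z = {}" if "y \<in> Z" for y
    using insert.prems(2) insert.hyps that unfolding disjoint_family_on_def by (metis insert_iff)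
  have IH: "real (card (?G ?W Z)) \<le> 2 ^ card ?W * (1 - 1 / 2 ^ t) ^ card Z"
  proof (rule insert.IH)
    show "disjoint_family_on Bl Z"
      using insert.prems(2) by (auto simp: disjoint_family_on_def)
    show "Bl y \<subseteq> ?W" if "y \<in> Z" for y
      using insert.prems(3)[of y] disj[OF that] that by blast
  qed (use insert.prems in auto)
  let ?h = "\<lambda>S. (S \<inter> Bl z, S - Bl z)"
  have "card (?G W (insert z Z)) \<le> card ((Pow (Bl z) - {Tg z}) \<times> ?G ?W Z)"
  proof (rule card_inj_on_le)
    show "inj_on ?h (?G W (insert z Z))"
      by (rule inj_onI) (metis Int_Diff_Un prod.inject)
    have "(S - Bl z) \<inter> Bl y = S \<inter> Bl y" if "y \<in> Z" for S y
      using disj[OF that] by blast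
    then show "?h ` ?G W (insert z Z) \<subseteq> (Pow (Bl z) - {Tg z}) \<times> ?G ?W Z"
      by auto
    show "finite ((Pow (Bl z) - {Tg z}) \<times> ?G ?W Z)" using fin by simp
  qed
  also have "\<dots> = (2 ^ card (Bl z) - 1) * card (?G ?W Z)"
    using fin insert.prems(5)[of z] by (simp add: card_cartesian_product card_Diff_subset card_Pow)
  finally have "real (card (?G W (insert z Z))) \<le> (2 ^ card (Bl z) - 1) * real (card (?G ?W Z))"
    by (metis (mono_tags, lifting) of_nat_mono of_nat_mult of_nat_1 of_nat_diff of_nat_power of_nat_numeral one_le_power one_le_numeral)
  also have "\<dots> \<le> (2 ^ card (Bl z) * (1 - 1 / 2 ^ t)) * (2 ^ card ?W * (1 - 1 / 2 ^ t) ^ card Z)"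
  proof (intro mult_mono IH)
    have "(2::real) ^ card (Bl z) \<le> 2 ^ t" using insert.prems(4)[of z] by simp
    then show "(2::real) ^ card (Bl z) - 1 \<le> 2 ^ card (Bl z) * (1 - 1 / 2 ^ t)"
      by (simp add: field_simps)
  qed auto
  also have "\<dots> = 2 ^ card W * (1 - 1 / 2 ^ t) ^ card (insert z Z)"
  proof -
    have "card W = card (Bl z) + card ?W"
      using fin by (simp add: card_Diff_subset card_mono)
    then show ?thesis using insert.hyps by (simp add: power_add algebra_simps)
  qed
  finally show ?case .
qed

text \<open>A set of at most \<open>L\<close> elements is read off from a list of length
  \<open>L\<close> padded with \<open>None\<close>; the padding symbol accounts for the
  \<open>+ 1\<close>.\<close>

lemma card_bounded_subsets:
  assumes "finite A"
  shows "card {D. D \<subseteq> A \<and> card D \<le> L} \<le> (card A + 1) ^ L"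
proof -
  let ?T = "{xs. set xs \<subseteq> insert None (Some ` A) \<and> length xs = L}"
  have fin: "finite (insert None (Some ` A))" using assms by simp
  have "{D. D \<subseteq> A \<and> card D \<le> L} \<subseteq> (\<lambda>xs. {a. Some a \<in> set xs}) ` ?T"
  proof
    fix D assume "D \<in> {D. D \<subseteq> A \<and> card D \<le> L}"
    then have D: "D \<subseteq> A" "card D \<le> L" by auto
    obtain ds where ds: "set ds = D" "length ds = card D"
      using finite_distinct_list[of D] D assms finite_subset distinct_card by metis
    let ?xs = "map Some ds @ replicate (L - card D) None"
    have "?xs \<in> ?T" using ds D by auto
    moreover have "D = {a. Some a \<in> set ?xs}" using ds by auto
    ultimately show "D \<in> (\<lambda>xs. {a. Some a \<in> set xs}) ` ?T" by blast
  qed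
  then have "card {D. D \<subseteq> A \<and> card D \<le> L} \<le> card ((\<lambda>xs. {a. Some a \<in> set xs}) ` ?T)"
    by (rule card_mono[rotated]) (simp add: finite_lists_length_eq[OF fin])
  also have "\<dots> \<le> card ?T" by (rule card_image_le) (simp add: finite_lists_length_eq[OF fin])
  also have "\<dots> = (card A + 1) ^ L"
    using assms by (simp add: card_lists_length_eq[OF fin] card_image)
  finally show ?thesis .
qed

text \<open>Take \<open>T0\<close> maximal. Any other point of \<open>T\<close> is the image of a
  point of \<open>T0\<close> or is sent into \<open>T0\<close>, since it could be added otherwise.
  Thus \<open>T\<close> is covered by three sets of size at most \<open>card T0\<close>, which is
  the origin of the factor 3.\<close>

lemma large_subset_disjoint_from_image:
  assumes "finite T" "inj_on g U" "T \<subseteq> U" "\<And>a. a \<in> T \<Longrightarrow> g a \<noteq> a"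
  obtains T0 where "T0 \<subseteq> T" "T0 \<inter> g ` T0 = {}" "card T \<le> 3 * card T0"
proof -
  let ?F = "{T0. T0 \<subseteq> T \<and> T0 \<inter> g ` T0 = {}}"
  have "finite ?F" "{} \<in> ?F" using assms by auto
  then obtain T0 where T0: "T0 \<in> ?F" and mx: "\<And>S. S \<in> ?F \<Longrightarrow> T0 \<subseteq> S \<Longrightarrow> S = T0"
    using finite_has_maximal2[of ?F "{}"] by (metis (lifting) )
  have "T \<subseteq> T0 \<union> g ` T0 \<union> {a \<in> T. g a \<in> T0}"
  proof
    fix a assume a: "a \<in> T"
    show "a \<in> T0 \<union> g ` T0 \<union> {a \<in> T. g a \<in> T0}"
    proof (rule ccontr)
      assume *: "\<not> ?thesis"
      then have "insert a T0 \<in> ?F" using a T0 assms(4)[OF a] by auto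
      from mx[OF this] * show False by auto
    qed
  qed
  then have "card T \<le> card (T0 \<union> g ` T0 \<union> {a \<in> T. g a \<in> T0})"
    using T0 assms(1) finite_subset by (intro card_mono) auto
  also have "\<dots> \<le> card T0 + card (g ` T0) + card {a \<in> T. g a \<in> T0}"
    by (meson add_le_mono1 card_Un_le order_trans)
  also have "card {a \<in> T. g a \<in> T0} \<le> card T0"
    using assms T0 finite_subset
    by (intro card_inj_on_le[of g]) (auto intro: inj_on_subset)
  also have "card (g ` T0) \<le> card T0"
    using T0 assms(1) finite_subset by (intro card_image_le) auto
  finally show ?thesis using that T0 by auto
qed

text \<open>The sum over all subsets is the expansion of \<open>(1 + y) ^ card A\<close>, and
  \<open>1 + y \<le> exp y\<close>; the empty set contributes the 1 that is subtracted. It serves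
  the union bound over the possible sets of moved points.\<close>

lemma sum_power_card_nonempty_le:
  fixes y :: real
  assumes "finite A" "0 \<le> y"
  shows "(\<Sum>T\<in>Pow A - {{}}. y ^ card T) \<le> exp (real (card A) * y) - 1"
proof -
  have "(\<Sum>T\<in>Pow A. y ^ card T) = (\<Prod>a\<in>A. y + 1)"
    using assms prod_add[of A "\<lambda>_. y" "\<lambda>_. 1"] by simp
  also have "\<dots> \<le> exp y ^ card A"
    using assms by (simp add: power_mono add.commute)
  also have "\<dots> = exp (real (card A) * y)" by (simp add: exp_of_nat_mult)
  finally show ?thesis using assms by (simp add: sum_diff1)
qed

section \<open>Limits of the two error bounds\<close>

lemma extension_error_tendsto:
  "(\<lambda>n. (real n + 1) ^ L * 2 ^ t * (1 - 1 / 2 ^ t) ^ (n - L)) \<longlonglongrightarrow> 0"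
proof -
  define c :: real where "c = 1 - 1 / 2 ^ t"
  have c: "0 \<le> c" "c < 1" by (auto simp: c_def)
  \<comment> \<open>The exponent \<open>n - L\<close> is a truncated difference, so the limit is
    taken along \<open>n = k + L\<close>.\<close>
  have "(\<lambda>k. (real (k + L) + 1) ^ L * 2 ^ t * c ^ k) \<longlonglongrightarrow> 0"
  \<comment> \<open>\<open>c = 0\<close> occurs for \<open>t = 0\<close>; the power then vanishes
    from \<open>k = 1\<close> on. The asymptotic expansion of the other case needs a positive
    base.\<close>
  proof (cases "c = 0")
    case True
    then show ?thesis by (intro tendsto_eventually) (auto intro!: eventually_sequentiallyI[of 1])
  next
    case False
    then have "c > 0" using c by simp
    then show ?thesis using c by real_asymp
  qed
  then have "(\<lambda>k. (real (k + L) + 1) ^ L * 2 ^ t * c ^ ((k + L) - L)) \<longlonglongrightarrow> 0" by simp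
  from LIMSEQ_offset[of "\<lambda>n. (real n + 1) ^ L * 2 ^ t * c ^ (n - L)" L, OF this] show ?thesis by (simp add: c_def)
qed

lemma support_error_tendsto:
  "(\<lambda>n. exp (real n * (real n ^ (m + 1) * 2 powr (- (real n - real m) / 3))) - 1) \<longlonglongrightarrow> 0"
  by real_asymp

section \<open>Extension properties and elementary equivalence\<close>

text \<open>Says that sending \<open>g u\<close> to \<open>g' u\<close> is a partial isomorphism.
  Tuples over an index set allow repetitions, so constants and variables can be kept together even
  when a variable takes the value of a constant.\<close>

definition same_type ::
  "('r \<Rightarrow> nat) \<Rightarrow> ('r, 'a) rstruct \<Rightarrow> ('r, 'b) rstruct \<Rightarrow> 'i set \<Rightarrow> ('i \<Rightarrow> 'a) \<Rightarrow> ('i \<Rightarrow> 'b) \<Rightarrow> bool" where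
  "same_type ar M N J g g' \<longleftrightarrow>
     (\<forall>u\<in>J. \<forall>v\<in>J. g u = g v \<longleftrightarrow> g' u = g' v) \<and>
     (\<forall>R us. set us \<subseteq> J \<and> length us = ar R \<longrightarrow> (map g us \<in> rel M R \<longleftrightarrow> map g' us \<in> rel N R))"

lemma same_type_sym: "same_type ar M N J g g' \<Longrightarrow> same_type ar N M J g' g"
  unfolding same_type_def by auto

lemma same_type_subset: "same_type ar M N J g g' \<Longrightarrow> I \<subseteq> J \<Longrightarrow> same_type ar M N I g g'"
  unfolding same_type_def by (meson subset_iff)

text \<open>
  The element \<open>0\<close> lies in no structure with universe \<open>{1..n}\<close> and serves as the variable for a
  point that extends \<open>D\<close>. A set \<open>Q\<close> of patterns is a quantifier-free description of such a point.
\<close>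

definition patterns :: "('r \<Rightarrow> nat) \<Rightarrow> nat set \<Rightarrow> ('r \<times> nat list) set" where
  "patterns ar D = {(R, xs). length xs = ar R \<and> set xs \<subseteq> insert 0 D \<and> 0 \<in> set xs}"

text \<open>\<open>X\<close> is the set of constants and \<open>K\<close> the group acting on it.
  Only invariant \<open>Q\<close> are requested because \<open>K\<close> fixes every point outside
  \<open>X\<close>: in a \<open>K\<close>-invariant structure a new point has a
  \<open>K\<close>-invariant description.\<close>

definition extension_property ::
  "('r \<Rightarrow> nat) \<Rightarrow> nat set \<Rightarrow> (nat \<Rightarrow> nat) set \<Rightarrow> nat \<Rightarrow> ('r, nat) rstruct \<Rightarrow> bool" where
  "extension_property ar X K L M \<longleftrightarrow>
     (\<forall>D Q. X \<subseteq> D \<and> D \<subseteq> universe M \<and> card D \<le> L \<and> Q \<subseteq> patterns ar D \<and>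
        (\<forall>p\<in>K. \<forall>R xs. (R, xs) \<in> Q \<longrightarrow> (R, map p xs) \<in> Q) \<longrightarrow>
        (\<exists>z\<in>universe M - D. \<forall>(R, xs)\<in>patterns ar D. map (id(0 := z)) xs \<in> rel M R \<longleftrightarrow> (R, xs) \<in> Q))"

text \<open>One move of the game: a point that is already named is answered by the same index, and a
  new one by realizing its transported description. The hypothesis \<open>lift\<close> says that
  each \<open>p'\<close> acts on indices in the same way as some \<open>p\<close>; through it the
  invariance of \<open>M\<close> becomes the invariance of the transported description.\<close>

lemma same_type_extend:
  fixes M M' :: "('r, nat) rstruct" and g g' :: "'i \<Rightarrow> nat"
  assumes st: "same_type ar M M' J g g'"
    and z: "z \<in> universe M"
    and new: "new \<notin> J" and g': "g' ` J \<subseteq> universe M'" "0 \<notin> universe M'"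
    and X: "X \<subseteq> g ` J" "X' \<subseteq> g' ` J"
    and ext: "extension_property ar X' K' L M'" "card (g' ` J) \<le> L"
    and K: "\<And>p. p \<in> K \<Longrightarrow> p permutes X" and K': "\<And>p. p \<in> K' \<Longrightarrow> p permutes X'"
    and inv: "\<And>p R xs. p \<in> K \<Longrightarrow> xs \<in> rel M R \<Longrightarrow> map p xs \<in> rel M R"
    and lift: "\<And>p'. p' \<in> K' \<Longrightarrow>
      \<exists>p\<in>K. \<exists>k. \<forall>u\<in>J. k u \<in> J \<and> g' (k u) = p' (g' u) \<and> g (k u) = p (g u)"
  shows "\<exists>z'\<in>universe M'. same_type ar M M' (insert new J) (g(new := z)) (g'(new := z'))"
proof (cases "z \<in> g ` J")
  case True
  then obtain w where w: "w \<in> J" "z = g w" by auto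
  \<comment> \<open>Replacing \<open>new\<close> by \<open>w\<close> reduces every condition on
    \<open>insert new J\<close> to one on \<open>J\<close>.\<close>
  define s where "s = (\<lambda>v. if v = new then w else v)"
  have s: "g(new := z) = g \<circ> s" "g'(new := g' w) = g' \<circ> s"
    unfolding s_def fun_eq_iff w(2) by simp_all
  have sJ: "s v \<in> J" if "v \<in> insert new J" for v using that w(1) by (auto simp: s_def)
  have "same_type ar M M' (insert new J) (g \<circ> s) (g' \<circ> s)"
    unfolding same_type_def
  proof (intro conjI ballI allI impI)
    fix u v assume "u \<in> insert new J" "v \<in> insert new J"
    then show "((g \<circ> s) u = (g \<circ> s) v) = ((g' \<circ> s) u = (g' \<circ> s) v)"
      using st sJ unfolding same_type_def by (metis comp_apply)
  next
    fix R us assume us: "set us \<subseteq> insert new J \<and> length us = ar R"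
    then have "set (map s us) \<subseteq> J \<and> length (map s us) = ar R" using sJ by fastforce
    then have "map g (map s us) \<in> rel M R \<longleftrightarrow> map g' (map s us) \<in> rel M' R"
      using st unfolding same_type_def by blast
    then show "(map (g \<circ> s) us \<in> rel M R) = (map (g' \<circ> s) us \<in> rel M' R)"
      by simp
  qed
  then have "same_type ar M M' (insert new J) (g(new := z)) (g'(new := g' w))"
    by (simp only: s)
  then show ?thesis using w g' by blast
next
  case False
  let ?D = "g' ` J" and ?J = "insert new J"
  \<comment> \<open>The answer is not known yet, so the placeholder 0 stands for it on the side of
    \<open>M'\<close>.\<close>
  let ?g = "g(new := z)" and ?h = "g'(new := 0)"
  define Q where "Q = {(R, xs). \<exists>us. length us = ar R \<and> set us \<subseteq> ?J \<and> new \<in> set us \<and>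
    xs = map ?h us \<and> map ?g us \<in> rel M R}"
  have nD: "0 \<notin> ?D" using g' by auto
  have eqJ: "g u = g v \<longleftrightarrow> g' u = g' v" if "u \<in> J" "v \<in> J" for u v
    using st that unfolding same_type_def by auto
  have eq: "?g u = ?g v \<longleftrightarrow> ?h u = ?h v" if "u \<in> ?J" "v \<in> ?J" for u v
    using that eqJ False nD by (auto simp: image_iff)
  have Qsub: "Q \<subseteq> patterns ar ?D"
    unfolding Q_def patterns_def by (force simp: image_iff)
  have Qinv: "(R, map p' xs) \<in> Q" if p': "p' \<in> K'" and Q: "(R, xs) \<in> Q" for p' R xs
  proof -
    obtain us where us: "length us = ar R" "set us \<subseteq> ?J" "new \<in> set us"
      "xs = map ?h us" "map ?g us \<in> rel M R"
      using Q unfolding Q_def by auto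
    obtain p k where p: "p \<in> K" and k: "\<And>u. u \<in> J \<Longrightarrow> k u \<in> J \<and> g' (k u) = p' (g' u) \<and> g (k u) = p (g u)"
      using lift[OF p'] by blast
    \<comment> \<open>The action on indices extends by fixing \<open>new\<close>: \<open>z\<close>
      lies outside \<open>X\<close> and 0 lies outside \<open>X'\<close>, so both permutations fix
      the extra point.\<close>
    let ?k = "k(new := new)"
    have zX: "p z = z" using K[OF p] False X by (meson permutes_not_in subsetD)
    have zX': "p' 0 = 0" using K'[OF p'] nD X by (meson permutes_not_in subsetD)
    have 1: "map ?h (map ?k us) = map p' xs"
      using us k new zX' by (auto simp: subset_iff)
    have 2: "map ?g (map ?k us) = map p (map ?g us)"
      using us k new zX by (auto simp: subset_iff)
    have "set (map ?k us) \<subseteq> ?J" "new \<in> set (map ?k us)" using us k new by (auto simp: subset_iff)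
    moreover have "map ?g (map ?k us) \<in> rel M R" unfolding 2 using inv[OF p us(5)] .
    ultimately have "length (map ?k us) = ar R \<and> set (map ?k us) \<subseteq> ?J \<and> new \<in> set (map ?k us) \<and>
       map p' xs = map ?h (map ?k us) \<and> map ?g (map ?k us) \<in> rel M R"
      using us(1) unfolding 1 by simp
    then show ?thesis unfolding Q_def by blast
  qed
  obtain z' where z': "z' \<in> universe M' - ?D"
    and real: "\<And>R xs. (R, xs) \<in> patterns ar ?D \<Longrightarrow> map (id(0 := z')) xs \<in> rel M' R \<longleftrightarrow> (R, xs) \<in> Q"
  proof -
    have "\<exists>z\<in>universe M' - ?D. \<forall>(R, xs)\<in>patterns ar ?D. map (id(0 := z)) xs \<in> rel M' R \<longleftrightarrow> (R, xs) \<in> Q"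
      using ext(1) unfolding extension_property_def
      by (elim allE[of _ ?D] allE[of _ Q] mp) (simp add: ext(2) Qsub Qinv g'(1) X(2))
    then show ?thesis using that by blast
  qed
  have "same_type ar M M' ?J ?g (g'(new := z'))"
    unfolding same_type_def
  proof (intro conjI ballI allI impI)
    fix u v assume "u \<in> ?J" "v \<in> ?J"
    then show "(?g u = ?g v) = ((g'(new := z')) u = (g'(new := z')) v)"
      using eqJ False z' by (auto simp: image_iff)
  next
    fix R us assume us: "set us \<subseteq> ?J \<and> length us = ar R"
    show "(map ?g us \<in> rel M R) = (map (g'(new := z')) us \<in> rel M' R)"
    proof (cases "new \<in> set us")
      case False
      have "map ?g us = map g us" "map (g'(new := z')) us = map g' us" "set us \<subseteq> J"
        using False us by auto
      then show ?thesis using st us unfolding same_type_def by metis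
    next
      case True
      have "map (g'(new := z')) us = map (id(0 := z')) (map ?h us)"
        using us nD by (auto simp: subset_iff)
      moreover have "(R, map ?h us) \<in> patterns ar ?D"
        using us True unfolding patterns_def by (force simp: image_iff)
      moreover have "(R, map ?h us) \<in> Q \<longleftrightarrow> map ?g us \<in> rel M R"
      proof
        \<comment> \<open>Membership in \<open>Q\<close> may be witnessed by another index list
          \<open>vs\<close>. By \<open>eq\<close>, indices with equal \<open>?h\<close>-values have
          equal \<open>?g\<close>-values, so the witness may be exchanged.\<close>
        assume "(R, map ?h us) \<in> Q"
        then obtain vs where vs: "set vs \<subseteq> ?J" "map ?h us = map ?h vs" "map ?g vs \<in> rel M R"
          unfolding Q_def by auto
        have "map ?g us = map ?g vs"
        proof (rule nth_equalityI)
          show l: "length (map ?g us) = length (map ?g vs)" using vs(2) map_eq_imp_length_eq by auto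
          fix i assume "i < length (map ?g us)"
          then have i: "i < length us" "i < length vs" using l by auto
          then have "us ! i \<in> ?J" "vs ! i \<in> ?J" using us vs(1) nth_mem by blast+
          moreover have "?h (us ! i) = ?h (vs ! i)" using vs(2) i by (metis nth_map)
          ultimately have "?g (us ! i) = ?g (vs ! i)" using eq by blast
          then show "map ?g us ! i = map ?g vs ! i" using i by (simp only: nth_map)
        qed
        then show "map ?g us \<in> rel M R" using vs(3) by (simp only:)
      qed (use us True in \<open>auto simp: Q_def\<close>)
      ultimately show ?thesis using real by metis
    qed
  qed
  then show ?thesis using z' by blast
qed

text \<open>The game keeps only the values of free variables. Together with \<open>card I\<close>,
  this bounds the parameter sets over which the extension property is invoked.\<close>

primrec width :: "'r fm \<Rightarrow> nat" where
  "width (Eq x y) = 0"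
| "width (Rel R xs) = 0"
| "width (Neg \<phi>) = width \<phi>"
| "width (And \<phi> \<psi>) = max (width \<phi>) (width \<psi>)"
| "width (Exists x \<phi>) = max (card (free_vars \<phi>)) (width \<phi>)"

lemma finite_free_vars [simp]: "finite (free_vars \<phi>)"
  by (induction \<phi>) auto

text \<open>The conjugate of \<open>h\<close> by \<open>f\<close>, extended by the identity to all
  points. Unlike the extensional functions of \<open>conj_group\<close>, it can be mapped over
  tuples that leave the image of \<open>f\<close>, and it composes by plain
  \<open>\<circ>\<close>.\<close>

definition conj_ext :: "('a \<Rightarrow> 'b) \<Rightarrow> 'a set \<Rightarrow> ('a \<Rightarrow> 'a) \<Rightarrow> 'b \<Rightarrow> 'b" where
  "conj_ext f I h = (\<lambda>y. if y \<in> f ` I then f (h (inv_into I f y)) else y)"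

lemma conj_ext_apply [simp]: "inj_on f I \<Longrightarrow> i \<in> I \<Longrightarrow> conj_ext f I h (f i) = f (h i)"
  by (simp add: conj_ext_def)

lemma conj_ext_outside [simp]: "y \<notin> f ` I \<Longrightarrow> conj_ext f I h y = y"
  by (simp add: conj_ext_def)

text \<open>The \<open>f\<close>-image of \<open>I\<close> plays the role of a tuple of constants, on which \<open>H\<close> acts.\<close>

definition generic ::
  "('r \<Rightarrow> nat) \<Rightarrow> nat set \<Rightarrow> (nat \<Rightarrow> nat) set \<Rightarrow> nat \<Rightarrow> (nat \<Rightarrow> nat) \<Rightarrow> ('r, nat) rstruct \<Rightarrow> bool" where
  "generic ar I H L f M \<longleftrightarrow>
     inj_on f I \<and> f ` I \<subseteq> universe M \<and> 0 \<notin> universe M \<and>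
     (\<forall>h\<in>H. \<forall>R xs. xs \<in> rel M R \<longrightarrow> map (conj_ext f I h) xs \<in> rel M R) \<and>
     extension_property ar (f ` I) (conj_ext f I ` H) L M"

lemma conj_ext_permutes:
  assumes "inj_on f I" "bij_betw h I I"
  shows "conj_ext f I h permutes f ` I"
proof (rule bij_imp_permutes)
  have "bij_betw (f \<circ> h \<circ> inv_into I f) (f ` I) (f ` I)"
    using assms by (meson bij_betw_inv_into bij_betw_trans inj_on_imp_bij_betw)
  then show "bij_betw (conj_ext f I h) (f ` I) (f ` I)"
    by (rule bij_betw_cong[THEN iffD1, rotated]) (simp add: conj_ext_def)
qed simp

text \<open>Indices \<open>Inl i\<close> name constants and indices \<open>Inr v\<close> name
  variables. The content is the hypothesis \<open>lift\<close> of \<open>same_type_extend\<close>: a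
  single element of \<open>H\<close> induces the permutations on both sides.\<close>

lemma generic_extend:
  assumes M: "generic ar I H L f M" and M': "generic ar I H L f' M'"
    and I: "finite I" and H: "\<And>h. h \<in> H \<Longrightarrow> bij_betw h I I"
    and V: "finite (V :: nat set)" "x \<notin> V" "card I + card V \<le> L"
    and e': "e' ` V \<subseteq> universe M'" and a: "a \<in> universe M"
    and st: "same_type ar M M' (Inl ` I \<union> Inr ` V) (case_sum f e) (case_sum f' e')"
  shows "\<exists>a'\<in>universe M'. same_type ar M M' (Inl ` I \<union> Inr ` insert x V)
    (case_sum f (e(x := a))) (case_sum f' (e'(x := a')))"
proof -
  let ?J = "Inl ` I \<union> Inr ` V"
  let ?g = "case_sum f e" and ?g' = "case_sum f' e'"
  have inj: "inj_on f I" "inj_on f' I" using M M' by (auto simp: generic_def)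
  have ex: "\<exists>a'\<in>universe M'. same_type ar M M' (insert (Inr x) ?J) (?g(Inr x := a)) (?g'(Inr x := a'))"
  proof (rule same_type_extend[OF st a, where X = "f ` I" and X' = "f' ` I"
        and K = "conj_ext f I ` H" and K' = "conj_ext f' I ` H"])
    show "Inr x \<notin> ?J" using V by auto
    show "?g' ` ?J \<subseteq> universe M'" "0 \<notin> universe M'" using M' e' by (auto simp: generic_def)
    show "f ` I \<subseteq> ?g ` ?J" "f' ` I \<subseteq> ?g' ` ?J" by (auto simp: image_Un image_image)
    show "extension_property ar (f' ` I) (conj_ext f' I ` H) L M'" using M' by (simp add: generic_def)
    have "card (?g' ` ?J) \<le> card ?J" using I V by (intro card_image_le) auto
    also have "\<dots> = card I + card V"
      using I V by (subst card_Un_disjoint) (auto simp: card_image)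
    finally show "card (?g' ` ?J) \<le> L" using V by simp
    show "p permutes f ` I" if "p \<in> conj_ext f I ` H" for p
      using that conj_ext_permutes[OF inj(1)] H by auto
    show "p permutes f' ` I" if "p \<in> conj_ext f' I ` H" for p
      using that conj_ext_permutes[OF inj(2)] H by auto
    show "map p xs \<in> rel M R" if "p \<in> conj_ext f I ` H" "xs \<in> rel M R" for p xs R
      using M that by (auto simp: generic_def)
    fix p' assume "p' \<in> conj_ext f' I ` H"
    then obtain h where h: "h \<in> H" "p' = conj_ext f' I h" by auto
    \<comment> \<open>An index with value \<open>f i\<close> goes to \<open>Inl (h i)\<close>, even
      if it is a variable; all others stay. Since the types agree, an index has value
      \<open>f i\<close> exactly if it has value \<open>f' i\<close> on the other side, so this one
      map serves both structures.\<close>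
    let ?k = "\<lambda>u. if ?g u \<in> f ` I then Inl (h (inv_into I f (?g u))) else u"
    have k: "?k u \<in> ?J \<and> ?g' (?k u) = p' (?g' u) \<and> ?g (?k u) = conj_ext f I h (?g u)"
      if u: "u \<in> ?J" for u
    proof (cases "?g u \<in> f ` I")
      case True
      then obtain i where i: "i \<in> I" "?g u = f i" by auto
      then have "?g u = ?g (Inl i)" by simp
      then have "?g' u = ?g' (Inl i)" using st u i unfolding same_type_def by blast
      then have "?g' u = f' i" by simp
      moreover have "h i \<in> I" using H[OF h(1)] i by (meson bij_betwE)
      ultimately show ?thesis using i h inj by simp
    next
      case False
      have "?g' u \<notin> f' ` I"
      proof
        assume "?g' u \<in> f' ` I"
        then obtain i where i: "i \<in> I" "?g' u = ?g' (Inl i)" by auto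
        then have "?g u = ?g (Inl i)" using st u i unfolding same_type_def by blast
        then show False using False i by auto
      qed
      then show ?thesis using False u h by simp
    qed
    show "\<exists>p\<in>conj_ext f I ` H. \<exists>k. \<forall>u\<in>?J. k u \<in> ?J \<and> ?g' (k u) = p' (?g' u) \<and> ?g (k u) = p (?g u)"
      by (rule bexI[of _ "conj_ext f I h"], rule exI[of _ ?k], rule ballI, rule k) (use h in auto)
  qed
  have upd: "(case_sum f0 e0)(Inr x := b) = case_sum f0 (e0(x := b))" for f0 e0 :: "nat \<Rightarrow> nat" and b
    by (auto simp: fun_eq_iff split: sum.splits)
  show ?thesis using ex by (simp only: upd Un_insert_right image_insert)
qed

lemma generic_sat_iff:
  assumes M: "generic ar I H L f M" and M': "generic ar I H L f' M'"
    and I: "finite I" and H: "\<And>h. h \<in> H \<Longrightarrow> bij_betw h I I"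
    and "wf_fm ar \<phi>" "card I + width \<phi> \<le> L"
    and "e ` free_vars \<phi> \<subseteq> universe M" "e' ` free_vars \<phi> \<subseteq> universe M'"
    and "same_type ar M M' (Inl ` I \<union> Inr ` free_vars \<phi>) (case_sum f e) (case_sum f' e')"
  shows "sat M e \<phi> \<longleftrightarrow> sat M' e' \<phi>"
  using assms(5-)
proof (induction \<phi> arbitrary: e e')
  case (Eq x y)
  have "same_type ar M M' (Inr ` {x, y}) (case_sum f e) (case_sum f' e')"
    by (rule same_type_subset[OF Eq.prems(5)]) simp
  then have "\<And>u v. u \<in> Inr ` {x, y} \<Longrightarrow> v \<in> Inr ` {x, y} \<Longrightarrow>
      case_sum f e u = case_sum f e v \<longleftrightarrow> case_sum f' e' u = case_sum f' e' v"
    unfolding same_type_def by blast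
  from this[of "Inr x" "Inr y"] show ?case by simp
next
  case (Rel R xs)
  then have "\<And>us. set us \<subseteq> Inr ` set xs \<and> length us = ar R \<Longrightarrow>
      map (case_sum f e) us \<in> rel M R \<longleftrightarrow> map (case_sum f' e') us \<in> rel M' R"
    unfolding same_type_def by (metis free_vars.simps(2) le_supI2)
  from this[of "map Inr xs"] show ?case using Rel by (simp add: comp_def)
next
  case (Neg \<phi>)
  then show ?case by simp
next
  case (And \<phi> \<psi>)
  have "sat M e \<phi> = sat M' e' \<phi>"
    using And.prems(1-4)
    by (intro And.IH(1) same_type_subset[OF And.prems(5)]) auto
  moreover have "sat M e \<psi> = sat M' e' \<psi>"
    using And.prems(1-4)
    by (intro And.IH(2) same_type_subset[OF And.prems(5)]) auto
  ultimately show ?case by simp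
next
  case (Exists x \<phi>)
  \<comment> \<open>The old value of \<open>x\<close> is forgotten before \<open>x\<close> is
    reassigned, which keeps the parameter set within the bound given by
    \<open>width\<close>.\<close>
  let ?V = "free_vars \<phi> - {x}"
  have V: "finite ?V" "x \<notin> ?V" "free_vars \<phi> \<subseteq> insert x ?V" by auto
  have "card ?V \<le> card (free_vars \<phi>)" by (rule card_mono) auto
  then have c: "card I + card ?V \<le> L" using Exists.prems(2) by simp
  have st: "same_type ar M M' (Inl ` I \<union> Inr ` ?V) (case_sum f e) (case_sum f' e')"
    using Exists.prems by simp
  have e: "e ` ?V \<subseteq> universe M" "e' ` ?V \<subseteq> universe M'" using Exists.prems by auto
  have IH: "sat M (e(x := a)) \<phi> \<longleftrightarrow> sat M' (e'(x := a')) \<phi>"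
    if "a \<in> universe M" "a' \<in> universe M'"
      "same_type ar M M' (Inl ` I \<union> Inr ` insert x ?V) (case_sum f (e(x := a))) (case_sum f' (e'(x := a')))"
    for a a'
    using that(1,2) Exists.prems(1,2) e
    by (intro Exists.IH same_type_subset[OF that(3)]) auto
  show ?case
  proof
    assume "sat M e (Exists x \<phi>)"
    then obtain a where "a \<in> universe M" "sat M (e(x := a)) \<phi>" by auto
    then show "sat M' e' (Exists x \<phi>)"
      using IH generic_extend[OF M M' I H V(1,2) c e(2) _ st] by (metis sat.simps(5))
  next
    assume "sat M' e' (Exists x \<phi>)"
    then obtain a' where "a' \<in> universe M'" "sat M' (e'(x := a')) \<phi>" by auto
    then show "sat M e (Exists x \<phi>)"
      using IH generic_extend[OF M' M I H V(1,2) c e(1) _ same_type_sym[OF st]] same_type_sym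
      by (metis (no_types, lifting) sat.simps(5))
  qed
qed

text \<open>A sentence starts the game with only the constants named, and there the types agree
  because \<open>f\<close> and \<open>f'\<close> embed the same structure.\<close>

lemma generic_models_iff:
  assumes M: "generic ar I H L f M" and M': "generic ar I H L f' M'"
    and I: "finite I" "I \<noteq> {}" and H: "\<And>h. h \<in> H \<Longrightarrow> bij_betw h I I"
    and A: "universe A = I" "embedding ar A M f" "embedding ar A M' f'"
    and \<phi>: "sentence ar \<phi>" "card I + width \<phi> \<le> L"
  shows "models M \<phi> \<longleftrightarrow> models M' \<phi>"
proof -
  have inj: "inj_on f I" "inj_on f' I" using M M' by (auto simp: generic_def)
  have *: "sat M e \<phi> \<longleftrightarrow> sat M' e' \<phi>" for e e'
  proof (rule generic_sat_iff[OF M M' I(1) H])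
    have "same_type ar M M' (Inl ` I) (case_sum f e) (case_sum f' e')"
      unfolding same_type_def
    proof (intro conjI ballI allI impI)
      fix u v :: "nat + nat" assume "u \<in> Inl ` I" "v \<in> Inl ` I"
      then show "(case_sum f e u = case_sum f e v) = (case_sum f' e' u = case_sum f' e' v)"
        using inj by (auto simp: inj_on_eq_iff)
    next
      fix R and us :: "(nat + nat) list" assume us: "set us \<subseteq> Inl ` I \<and> length us = ar R"
      then have "us \<in> lists (Inl ` I)" by auto
      then obtain vs where vs: "us = map Inl vs" "vs \<in> lists I" unfolding lists_image by auto
      then have "length vs = ar R" "set vs \<subseteq> universe A" using us A by auto
      then show "(map (case_sum f e) us \<in> rel M R) = (map (case_sum f' e') us \<in> rel M' R)"
        using A unfolding embedding_def vs by (simp add: comp_def)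
    qed
    then show "same_type ar M M' (Inl ` I \<union> Inr ` free_vars \<phi>) (case_sum f e) (case_sum f' e')"
      using \<phi> by (simp add: sentence_def)
  qed (use \<phi> in \<open>auto simp: sentence_def\<close>)
  \<comment> \<open>\<open>models\<close> quantifies over valuations into the universe; one on each
    side is exhibited so that neither quantifier is vacuous.\<close>
  obtain i where "i \<in> I" using I by auto
  then have "f i \<in> universe M" "f' i \<in> universe M'" using M M' by (auto simp: generic_def)
  then have "range (\<lambda>_::nat. f i) \<subseteq> universe M" "range (\<lambda>_::nat. f' i) \<subseteq> universe M'" by auto
  then show ?thesis unfolding models_def using * by meson
qed

section \<open>Random structures invariant under a permutation group\<close>

text \<open>Bounds the number of patterns over at most \<open>L\<close> parameters; the
  \<open>+ 1\<close> counts the placeholder 0.\<close>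

definition pattern_bound :: "('r::finite \<Rightarrow> nat) \<Rightarrow> nat \<Rightarrow> nat" where
  "pattern_bound ar L = (\<Sum>R\<in>UNIV. (L + 1) ^ ar R)"

text \<open>The form of C(f) used for counting: \<open>B\<close> prescribes the relations inside
  \<open>X\<close>, and \<open>K\<close> is a group of permutations that move only points of
  \<open>X\<close>. Its members are total functions, so \<open>id\<close>, \<open>\<circ>\<close>
  and \<open>inv_into UNIV\<close> are the group operations.\<close>

locale invariant_class =
  fixes ar :: "'r::finite \<Rightarrow> nat" and X :: "nat set" and B :: "'r \<Rightarrow> nat list set"
    and K :: "(nat \<Rightarrow> nat) set" and n :: nat
  assumes X_subset: "X \<subseteq> {1..n}"
    and B_subset: "xs \<in> B R \<Longrightarrow> length xs = ar R \<and> set xs \<subseteq> X"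
    and B_invariant: "p \<in> K \<Longrightarrow> xs \<in> B R \<Longrightarrow> map p xs \<in> B R"
    and K_permutes: "p \<in> K \<Longrightarrow> p permutes X"
    and K_id: "id \<in> K"
    and K_comp: "p \<in> K \<Longrightarrow> q \<in> K \<Longrightarrow> p \<circ> q \<in> K"
    and K_inv: "p \<in> K \<Longrightarrow> inv_into UNIV p \<in> K"
begin

definition struct_class :: "('r, nat) rstruct set" where
  "struct_class = {M \<in> structs_n ar n.
     (\<forall>R xs. set xs \<subseteq> X \<longrightarrow> (xs \<in> rel M R \<longleftrightarrow> xs \<in> B R)) \<and>
     (\<forall>p\<in>K. \<forall>R xs. xs \<in> rel M R \<longrightarrow> map p xs \<in> rel M R)}"

text \<open>The facts that \<open>B\<close> leaves open.\<close>

definition atoms :: "('r \<times> nat list) set" where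
  "atoms = {(R, xs). length xs = ar R \<and> set xs \<subseteq> {1..n} \<and> \<not> set xs \<subseteq> X}"

definition orb :: "'r \<times> nat list \<Rightarrow> ('r \<times> nat list) set" where
  "orb \<alpha> = (\<lambda>p. (fst \<alpha>, map p (snd \<alpha>))) ` K"

definition orbs :: "('r \<times> nat list) set set" where
  "orbs = orb ` atoms"

text \<open>A bijection from the class onto all sets of orbits. A uniformly random structure thereby
  becomes one independent fair coin per orbit.\<close>

definition code :: "('r, nat) rstruct \<Rightarrow> ('r \<times> nat list) set set" where
  "code M = orb ` {(R, xs) \<in> atoms. xs \<in> rel M R}"

lemma orb_refl: "\<alpha> \<in> orb \<alpha>"
  unfolding orb_def using K_id by (auto intro!: image_eqI[of _ _ id])

lemma orbE:
  assumes "(R', ys) \<in> orb (R, xs)"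
  obtains p where "p \<in> K" "R' = R" "ys = map p xs"
  using assms unfolding orb_def by auto

lemma mem_orb: "p \<in> K \<Longrightarrow> (R, map p xs) \<in> orb (R, xs)"
  unfolding orb_def by auto

lemma orb_map:
  assumes "p \<in> K"
  shows "orb (R, map p xs) = orb (R, xs)"
proof
  show "orb (R, map p xs) \<subseteq> orb (R, xs)"
    unfolding orb_def using K_comp[OF _ assms] by auto
  have eq: "map q xs = map (q \<circ> inv_into UNIV p) (map p xs)" for q
    using permutes_inverses(2)[OF K_permutes[OF assms]] by simp
  show "orb (R, xs) \<subseteq> orb (R, map p xs)"
  proof
    fix \<alpha> assume "\<alpha> \<in> orb (R, xs)"
    then obtain q where q: "q \<in> K" "\<alpha> = (R, map q xs)" unfolding orb_def by auto
    then show "\<alpha> \<in> orb (R, map p xs)"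
      unfolding eq[of q] by (auto intro!: mem_orb K_comp K_inv assms simp del: map_map)
  qed
qed

lemma K_image: "p \<in> K \<Longrightarrow> x \<in> X \<Longrightarrow> p x \<in> X"
  using K_permutes permutes_in_image by metis

lemma K_outside: "p \<in> K \<Longrightarrow> x \<notin> X \<Longrightarrow> p x = x"
  using K_permutes permutes_not_in by metis

lemma K_image_subset_iff:
  assumes "p \<in> K" "X \<subseteq> D"
  shows "set (map p xs) \<subseteq> D \<longleftrightarrow> set xs \<subseteq> D"
proof -
  have "p x \<in> D \<longleftrightarrow> x \<in> D" for x
    using assms K_image[OF assms(1), of x] K_outside[OF assms(1), of x] by (cases "x \<in> X") auto
  then show ?thesis by auto
qed

lemma atoms_map: "p \<in> K \<Longrightarrow> (R, xs) \<in> atoms \<Longrightarrow> (R, map p xs) \<in> atoms"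
  using K_image_subset_iff[of p X xs] K_image_subset_iff[of p "{1..n}" xs] X_subset
  unfolding atoms_def by simp

lemma finite_atoms: "finite atoms"
proof -
  have "atoms \<subseteq> (SIGMA R:UNIV. {xs. set xs \<subseteq> {1..n} \<and> length xs = ar R})"
    unfolding atoms_def by auto
  then show ?thesis
    by (rule finite_subset) (intro finite_SigmaI finite_lists_length_eq; simp)
qed

lemma finite_orbs: "finite orbs"
  unfolding orbs_def using finite_atoms by simp

lemma struct_classD:
  assumes "M \<in> struct_class"
  shows "universe M = {1..n}" "\<And>R xs. set xs \<subseteq> X \<Longrightarrow> xs \<in> rel M R \<longleftrightarrow> xs \<in> B R"
    "\<And>p R xs. p \<in> K \<Longrightarrow> xs \<in> rel M R \<Longrightarrow> map p xs \<in> rel M R"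
    "\<And>R xs. xs \<in> rel M R \<Longrightarrow> length xs = ar R \<and> set xs \<subseteq> {1..n}"
  using assms unfolding struct_class_def structs_n_def is_structure_def by blast+

text \<open>Invariance under \<open>K\<close> makes the atoms of one orbit hold or fail
  together.\<close>

lemma orb_mem_code_iff:
  assumes "M \<in> struct_class" "(R, xs) \<in> atoms"
  shows "orb (R, xs) \<in> code M \<longleftrightarrow> xs \<in> rel M R"
proof
  assume "orb (R, xs) \<in> code M"
  then obtain R' ys where *: "orb (R, xs) = orb (R', ys)" "ys \<in> rel M R'"
    unfolding code_def by auto
  then have "(R, xs) \<in> orb (R', ys)" using orb_refl by metis
  then show "xs \<in> rel M R" using * struct_classD(3)[OF assms(1)] by (auto elim: orbE)
qed (use assms in \<open>auto simp: code_def\<close>)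

lemma code_subset: "code M \<subseteq> orbs"
  unfolding code_def orbs_def by auto

lemma code_inj: "inj_on code struct_class"
proof (rule inj_onI)
  fix M N assume M: "M \<in> struct_class" and N: "N \<in> struct_class" and eq: "code M = code N"
  have "xs \<in> rel M R \<longleftrightarrow> xs \<in> rel N R" for R xs
  proof (cases "set xs \<subseteq> X \<or> (R, xs) \<notin> atoms")
    case True
    then show ?thesis
      using struct_classD(2,4)[OF M] struct_classD(2,4)[OF N] unfolding atoms_def by blast
  next
    case False
    then show ?thesis
      using orb_mem_code_iff[OF M, of R xs] orb_mem_code_iff[OF N, of R xs] eq by auto
  qed
  then have "rel M = rel N" by auto
  then show "M = N" using struct_classD(1)[OF M] struct_classD(1)[OF N] by simp
qed

text \<open>Any choice of orbits can be added to \<open>B\<close>: \<open>K\<close> preserves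
  \<open>B\<close>, the atoms and their orbits, and no atom lies inside \<open>X\<close>, so the
  prescribed part is not disturbed.\<close>

lemma code_image: "code ` struct_class = Pow orbs"
proof
  show "code ` struct_class \<subseteq> Pow orbs" using code_subset by auto
  show "Pow orbs \<subseteq> code ` struct_class"
  proof
    fix S assume "S \<in> Pow orbs"
    then have S: "S \<subseteq> orbs" by simp
    define M :: "('r, nat) rstruct" where
      "M = \<lparr>universe = {1..n}, rel = (\<lambda>R. B R \<union> {xs. (R, xs) \<in> atoms \<and> orb (R, xs) \<in> S})\<rparr>"
    have "M \<in> struct_class"
      unfolding struct_class_def structs_n_def is_structure_def
    proof (intro CollectI conjI allI ballI impI)
      show "rel M R \<subseteq> {xs. length xs = ar R \<and> set xs \<subseteq> universe M}" for R
        using B_subset X_subset unfolding M_def atoms_def by fastforce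
      show "universe M = {1..n}" by (simp add: M_def)
      show "(xs \<in> rel M R) = (xs \<in> B R)" if "set xs \<subseteq> X" for R xs
        using that unfolding M_def atoms_def by simp
      show "map p xs \<in> rel M R" if "p \<in> K" "xs \<in> rel M R" for p R xs
        using that B_invariant atoms_map orb_map unfolding M_def by auto
    qed
    moreover have "code M = S"
    proof
      have "(R, xs) \<in> atoms \<Longrightarrow> xs \<notin> B R" for R xs
        using B_subset unfolding atoms_def by auto
      then show "code M \<subseteq> S" unfolding code_def M_def by auto
      show "S \<subseteq> code M"
      proof
        fix c assume c: "c \<in> S"
        then obtain R xs where "(R, xs) \<in> atoms" "c = orb (R, xs)"
          using S unfolding orbs_def by auto
        then show "c \<in> code M" using c unfolding code_def M_def by auto
      qed
    qed
    ultimately show "S \<in> code ` struct_class" by blast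
  qed
qed

lemma finite_struct_class: "finite struct_class"
  using finite_imageD[OF _ code_inj] code_image finite_orbs by simp

lemma card_struct_class: "card struct_class = 2 ^ card orbs"
  using card_image[OF code_inj] code_image card_Pow[OF finite_orbs] by simp

lemma card_le_by_code:
  assumes "\<And>M. M \<in> struct_class \<Longrightarrow> P M \<Longrightarrow> code M \<in> F" "finite F"
  shows "card {M \<in> struct_class. P M} \<le> card F"
  using assms code_inj by (intro card_inj_on_le[of code]) (auto intro: inj_on_subset)

section \<open>The extension property in a random structure\<close>

definition realizes :: "('r, nat) rstruct \<Rightarrow> nat set \<Rightarrow> ('r \<times> nat list) set \<Rightarrow> nat \<Rightarrow> bool" where
  "realizes M D Q z \<longleftrightarrow> (\<forall>(R, xs)\<in>patterns ar D. map (id(0 := z)) xs \<in> rel M R \<longleftrightarrow> (R, xs) \<in> Q)"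

text \<open>With all patterns over \<open>D\<close> as \<open>Q\<close>, this is the block of coins
  that decide the description of \<open>z\<close>; with a smaller \<open>Q\<close>, it is the
  outcome wanted on that block.\<close>

definition point_orbs :: "('r \<times> nat list) set \<Rightarrow> nat \<Rightarrow> ('r \<times> nat list) set set" where
  "point_orbs Q z = (\<lambda>(R, xs). orb (R, map (id(0 := z)) xs)) ` Q"

lemma pattern_atom:
  assumes "(R, xs) \<in> patterns ar D" "D \<subseteq> {1..n}" "z \<in> {1..n} - X"
  shows "(R, map (id(0 := z)) xs) \<in> atoms"
  using assms unfolding patterns_def atoms_def by auto

text \<open>An orbit in the block of \<open>z\<close> determines \<open>z\<close>: it is the only point outside \<open>D\<close> on its tuples.\<close>

lemma point_orbs_disjoint:
  assumes "X \<subseteq> D" "D \<subseteq> {1..n}"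
  shows "disjoint_family_on (point_orbs (patterns ar D)) ({1..n} - D)"
  unfolding disjoint_family_on_def
proof (intro ballI impI)
  fix y z assume y: "y \<in> {1..n} - D" and z: "z \<in> {1..n} - D" and "y \<noteq> z"
  show "point_orbs (patterns ar D) y \<inter> point_orbs (patterns ar D) z = {}"
  proof (rule ccontr)
    assume "\<not> ?thesis"
    then obtain R xs R' xs' where xs: "(R, xs) \<in> patterns ar D" and xs': "(R', xs') \<in> patterns ar D"
      and eq: "orb (R, map (id(0 := y)) xs) = orb (R', map (id(0 := z)) xs')"
      unfolding point_orbs_def by fastforce
    have "(R, map (id(0 := y)) xs) \<in> orb (R', map (id(0 := z)) xs')"
      using orb_refl eq by metis
    then obtain p where p: "p \<in> K" "map (id(0 := y)) xs = map p (map (id(0 := z)) xs')"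
      by (elim orbE)
    have "y \<in> set (map (id(0 := y)) xs)" using xs unfolding patterns_def by force
    then have "y \<in> set (map p (map (id(0 := z)) xs'))" using p(2) by simp
    moreover have "set (map p (map (id(0 := z)) xs')) \<subseteq> insert z D"
      using xs' assms(1) unfolding K_image_subset_iff[OF p(1) subset_insertI2[OF assms(1)]] patterns_def
      by auto
    ultimately show False using y \<open>y \<noteq> z\<close> by auto
  qed
qed

text \<open>One orbit may arise from several patterns. Two such patterns differ by an element of
  \<open>K\<close>, and the invariance of \<open>Q\<close> ensures that both or neither belong to
  \<open>Q\<close>.\<close>

lemma realizes_if_code:
  assumes M: "M \<in> struct_class" and D: "X \<subseteq> D" "D \<subseteq> {1..n}" and z: "z \<in> {1..n} - D"
    and Q: "Q \<subseteq> patterns ar D" "\<And>p R xs. p \<in> K \<Longrightarrow> (R, xs) \<in> Q \<Longrightarrow> (R, map p xs) \<in> Q"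
    and code: "code M \<inter> point_orbs (patterns ar D) z = point_orbs Q z"
  shows "realizes M D Q z"
  unfolding realizes_def
proof (clarify)
  fix R xs assume xs: "(R, xs) \<in> patterns ar D"
  let ?s = "map (id(0 := z))"
  have zX: "z \<notin> X" using D z by auto
  have "?s xs \<in> rel M R \<longleftrightarrow> orb (R, ?s xs) \<in> code M"
    using orb_mem_code_iff[OF M pattern_atom[OF xs D(2)]] z zX by auto
  also have "\<dots> \<longleftrightarrow> orb (R, ?s xs) \<in> point_orbs Q z"
  proof -
    have "orb (R, ?s xs) \<in> point_orbs (patterns ar D) z"
      unfolding point_orbs_def by (rule image_eqI[OF _ xs]) simp
    then show ?thesis using code by blast
  qed
  also have "\<dots> \<longleftrightarrow> (R, xs) \<in> Q"
  proof
    assume "orb (R, ?s xs) \<in> point_orbs Q z"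
    then obtain R' ys where ys: "(R', ys) \<in> Q" "orb (R, ?s xs) = orb (R', ?s ys)"
      unfolding point_orbs_def by auto
    then have "(R, ?s xs) \<in> orb (R', ?s ys)" using orb_refl by metis
    then obtain p where p: "p \<in> K" "R = R'" "?s xs = map p (?s ys)" by (elim orbE) auto
    have "0 \<notin> X" using X_subset by auto
    then have p0: "p 0 = 0" "p z = z" using K_outside[OF p(1)] zX by auto
    have nz: "x \<noteq> z" if "x \<in> set xs" for x using that xs z unfolding patterns_def by auto
    have nz': "p y \<noteq> z" if "y \<in> set ys" for y
    proof
      assume "p y = z"
      then have "y = z" using p0(2) permutes_inj[OF K_permutes[OF p(1)]] by (metis injD)
      then show False using that ys(1) Q(1) z unfolding patterns_def by auto
    qed
    \<comment> \<open>The substitution of \<open>z\<close> for 0 can be cancelled: \<open>p\<close>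
      fixes both 0 and \<open>z\<close>, and \<open>z\<close> occurs neither in \<open>xs\<close>
      nor in \<open>map p ys\<close>.\<close>
    have "xs = map p ys"
    proof (rule nth_equalityI)
      show len: "length xs = length (map p ys)" using p(3) map_eq_imp_length_eq by fastforce
      fix i assume "i < length xs"
      then have i: "i < length xs" "i < length ys" using len by auto
      have "(id(0 := z)) (xs ! i) = p ((id(0 := z)) (ys ! i))"
        using p(3) i by (metis (no_types, lifting) length_map nth_map)
      moreover have "xs ! i \<noteq> z" "p (ys ! i) \<noteq> z" using nz nz' i by auto
      moreover have "p (ys ! i) = 0 \<longleftrightarrow> ys ! i = 0"
        using p0(1) permutes_inj[OF K_permutes[OF p(1)]] by (metis injD)
      ultimately show "xs ! i = map p ys ! i" using p0 i by (auto split: if_splits)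
    qed
    then show "(R, xs) \<in> Q" using Q(2)[OF p(1)] ys(1) p(2) by auto
  qed (auto simp: point_orbs_def)
  finally show "?s xs \<in> rel M R \<longleftrightarrow> (R, xs) \<in> Q" .
qed

lemma card_patterns:
  assumes "finite D" "card D \<le> L"
  shows "finite (patterns ar D)" "card (patterns ar D) \<le> pattern_bound ar L"
proof -
  let ?S = "SIGMA R:UNIV. {xs. set xs \<subseteq> insert 0 D \<and> length xs = ar R}"
  have sub: "patterns ar D \<subseteq> ?S" unfolding patterns_def by auto
  have fin: "finite (insert 0 D)" using assms by simp
  have finS: "finite ?S" by (intro finite_SigmaI finite_lists_length_eq fin) simp
  show "finite (patterns ar D)" using sub finS by (rule finite_subset)
  have "card (patterns ar D) \<le> card ?S" using sub finS by (rule card_mono[rotated])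
  also have "\<dots> = (\<Sum>R\<in>UNIV. card (insert 0 D) ^ ar R)"
    using fin by (simp add: card_SigmaI finite_lists_length_eq card_lists_length_eq)
  also have "\<dots> \<le> pattern_bound ar L"
    unfolding pattern_bound_def using assms
    by (intro sum_mono power_mono) (auto simp: card_insert_if)
  finally show "card (patterns ar D) \<le> pattern_bound ar L" .
qed

text \<open>The points outside \<open>D\<close> number at least \<open>n - L\<close>, and their
  disjoint blocks have at most \<open>pattern_bound ar L\<close> coins each, so
  \<open>card_avoid_blocks\<close> applies.\<close>

lemma card_not_realized:
  assumes D: "X \<subseteq> D" "D \<subseteq> {1..n}" "card D \<le> L"
    and Q: "Q \<subseteq> patterns ar D" "\<And>p R xs. p \<in> K \<Longrightarrow> (R, xs) \<in> Q \<Longrightarrow> (R, map p xs) \<in> Q"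
  shows "real (card {M \<in> struct_class. \<forall>z\<in>{1..n} - D. \<not> realizes M D Q z})
    \<le> (1 - 1 / 2 ^ pattern_bound ar L) ^ (n - L) * card struct_class"
proof -
  let ?Z = "{1..n} - D" and ?c = "1 - 1 / 2 ^ pattern_bound ar L :: real"
  let ?F = "{S \<in> Pow orbs. \<forall>z\<in>?Z. S \<inter> point_orbs (patterns ar D) z \<noteq> point_orbs Q z}"
  have finD: "finite D" using D(2) finite_subset by blast
  have sub: "point_orbs (patterns ar D) z \<subseteq> orbs" if "z \<in> ?Z" for z
  proof -
    have "z \<in> {1..n} - X" using that D by auto
    then show ?thesis using pattern_atom[OF _ D(2)] unfolding point_orbs_def orbs_def by auto
  qed
  have "card {M \<in> struct_class. \<forall>z\<in>?Z. \<not> realizes M D Q z} \<le> card ?F"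
  proof (rule card_le_by_code)
    show "code M \<in> ?F" if "M \<in> struct_class" "\<forall>z\<in>?Z. \<not> realizes M D Q z" for M
      using realizes_if_code[OF that(1) D(1,2) _ Q] that(2) code_subset[of M] by blast
  qed (use finite_orbs in simp)
  then have "real (card {M \<in> struct_class. \<forall>z\<in>?Z. \<not> realizes M D Q z}) \<le> real (card ?F)" by simp
  also have "\<dots> \<le> 2 ^ card orbs * ?c ^ card ?Z"
  proof (rule card_avoid_blocks)
    show "disjoint_family_on (point_orbs (patterns ar D)) ?Z" using point_orbs_disjoint[OF D(1,2)] .
    show "card (point_orbs (patterns ar D) z) \<le> pattern_bound ar L" for z
      unfolding point_orbs_def using card_patterns[OF finD D(3)] card_image_le order_trans by blast
    show "point_orbs Q z \<subseteq> point_orbs (patterns ar D) z" for z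
      unfolding point_orbs_def using Q(1) by auto
  qed (use sub finite_orbs in auto)
  also have "?c ^ card ?Z \<le> ?c ^ (n - L)"
  proof (rule power_decreasing)
    have "card ?Z = n - card D" using D finD by (simp add: card_Diff_subset)
    then show "n - L \<le> card ?Z" using D(3) by simp
  qed auto
  finally show ?thesis by (simp add: card_struct_class mult.commute)
qed

text \<open>Union bound: \<open>(n + 1) ^ L\<close> bounds the choices of \<open>D\<close>, and
  \<open>2 ^ pattern_bound ar L\<close> those of \<open>Q\<close>.\<close>

lemma card_not_extension_property:
  "real (card {M \<in> struct_class. \<not> extension_property ar X K L M})
    \<le> (real n + 1) ^ L * 2 ^ pattern_bound ar L * (1 - 1 / 2 ^ pattern_bound ar L) ^ (n - L) * card struct_class"
proof -
  let ?c = "(1 - 1 / 2 ^ pattern_bound ar L) ^ (n - L) * real (card struct_class)"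
  let ?Ds = "{D. D \<subseteq> {1..n} \<and> card D \<le> L}"
  let ?Qs = "\<lambda>D. {Q. X \<subseteq> D \<and> Q \<subseteq> patterns ar D \<and> (\<forall>p\<in>K. \<forall>R xs. (R, xs) \<in> Q \<longrightarrow> (R, map p xs) \<in> Q)}"
  let ?bad = "\<lambda>D Q. {M \<in> struct_class. \<forall>z\<in>{1..n} - D. \<not> realizes M D Q z}"
  have finDs: "finite ?Ds" by (rule finite_subset[of _ "Pow {1..n}"]) auto
  have pat: "finite (patterns ar D)" "card (patterns ar D) \<le> pattern_bound ar L" if "D \<in> ?Ds" for D
    using that card_patterns[of D L] finite_subset[of D "{1..n}"] by auto
  have Qs: "finite (?Qs D)" "card (?Qs D) \<le> 2 ^ pattern_bound ar L" if "D \<in> ?Ds" for D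
  proof -
    have sub: "?Qs D \<subseteq> Pow (patterns ar D)" by auto
    then show "finite (?Qs D)" using pat[OF that] by (meson finite_Pow_iff finite_subset)
    have "card (?Qs D) \<le> card (Pow (patterns ar D))" using sub pat[OF that] by (intro card_mono) auto
    also have "\<dots> \<le> 2 ^ pattern_bound ar L" using pat[OF that] by (simp add: card_Pow)
    finally show "card (?Qs D) \<le> 2 ^ pattern_bound ar L" .
  qed
  have "{M \<in> struct_class. \<not> extension_property ar X K L M} \<subseteq> (\<Union>D\<in>?Ds. \<Union>Q\<in>?Qs D. ?bad D Q)"
  proof
    fix M assume "M \<in> {M \<in> struct_class. \<not> extension_property ar X K L M}"
    then have M: "M \<in> struct_class" "\<not> extension_property ar X K L M" by auto
    then obtain D Q where "X \<subseteq> D \<and> D \<subseteq> {1..n} \<and> card D \<le> L \<and> Q \<subseteq> patterns ar D \<and>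
        (\<forall>p\<in>K. \<forall>R xs. (R, xs) \<in> Q \<longrightarrow> (R, map p xs) \<in> Q)"
      "\<not> (\<exists>z\<in>{1..n} - D. realizes M D Q z)"
      unfolding extension_property_def struct_classD(1)[OF M(1)] realizes_def[symmetric] by blast
    then have "D \<in> ?Ds" "Q \<in> ?Qs D" "M \<in> ?bad D Q" using M(1) by simp_all
    then show "M \<in> (\<Union>D\<in>?Ds. \<Union>Q\<in>?Qs D. ?bad D Q)" by (intro UN_I)
  qed
  then have "card {M \<in> struct_class. \<not> extension_property ar X K L M}
      \<le> card (\<Union>D\<in>?Ds. \<Union>Q\<in>?Qs D. ?bad D Q)"
    by (rule card_mono[rotated])
      (rule finite_subset[OF _ finite_struct_class], auto)
  also have "\<dots> \<le> (\<Sum>D\<in>?Ds. \<Sum>Q\<in>?Qs D. card (?bad D Q))"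
    by (rule order_trans[OF card_UN_le[OF finDs]], rule sum_mono, rule card_UN_le, rule Qs)
  finally have "real (card {M \<in> struct_class. \<not> extension_property ar X K L M})
      \<le> real (\<Sum>D\<in>?Ds. \<Sum>Q\<in>?Qs D. card (?bad D Q))" by (rule of_nat_mono)
  also have "\<dots> = (\<Sum>D\<in>?Ds. \<Sum>Q\<in>?Qs D. real (card (?bad D Q)))" by simp
  also have "\<dots> \<le> (\<Sum>D\<in>?Ds. \<Sum>Q\<in>?Qs D. ?c)"
    by (intro sum_mono card_not_realized) auto
  also have "\<dots> \<le> (\<Sum>D\<in>?Ds. 2 ^ pattern_bound ar L * ?c)"
  proof (rule sum_mono)
    fix D assume "D \<in> ?Ds"
    have "real (card (?Qs D)) \<le> real (2 ^ pattern_bound ar L)"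
      by (rule of_nat_mono, rule Qs(2)) fact
    then have "real (card (?Qs D)) \<le> 2 ^ pattern_bound ar L" by simp
    then show "(\<Sum>Q\<in>?Qs D. ?c) \<le> 2 ^ pattern_bound ar L * ?c"
      unfolding sum_constant by (rule mult_right_mono) auto
  qed
  also have "\<dots> = real (card ?Ds) * (2 ^ pattern_bound ar L * ?c)" by simp
  also have "\<dots> \<le> (real n + 1) ^ L * (2 ^ pattern_bound ar L * ?c)"
  proof (rule mult_right_mono)
    have "card ?Ds \<le> (n + 1) ^ L" using card_bounded_subsets[of "{1..n}" L] by simp
    then have "real (card ?Ds) \<le> real ((n + 1) ^ L)" by (rule of_nat_mono)
    then show "real (card ?Ds) \<le> (real n + 1) ^ L" by (simp add: add.commute)
  qed auto
  finally show ?thesis by (simp add: mult.assoc)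
qed

end

section \<open>Automorphisms of random structures\<close>

lemma Aut_bij: "g \<in> Aut ar M \<Longrightarrow> bij_betw g (universe M) (universe M)"
  unfolding Aut_def Bij_def by auto

context invariant_class
begin

text \<open>Shrink \<open>T\<close> to \<open>T0\<close> disjoint from its image. For
  \<open>a\<close> in \<open>T0\<close> and \<open>b\<close> outside \<open>X\<close>, the
  automorphism ties the fact on (a, b, ..., b) to the one on a tuple starting with
  \<open>g a\<close>, which is not in \<open>T0\<close>. So the coins of all these pairs are forced
  by the remaining coins and by \<open>B\<close>; they number at least
  \<open>card T * (n - card X) / 3\<close>.\<close>

lemma card_with_automorphism:
  assumes R: "2 \<le> ar R" and T: "T = {a \<in> {1..n} - X. g a \<noteq> a}"
  shows "real (card {M \<in> struct_class. g \<in> Aut ar M})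
    \<le> (2 powr (- (real n - real (card X)) / 3)) ^ card T * card struct_class"
proof (cases "bij_betw g {1..n} {1..n}")
  case False
  then have "{M \<in> struct_class. g \<in> Aut ar M} = {}"
    using Aut_bij struct_classD(1) by fastforce
  then have "card {M \<in> struct_class. g \<in> Aut ar M} = 0" by (simp only: card.empty)
  then show ?thesis by (simp only:) simp
next
  case g: True
  define Y where "Y = {1..n} - X"
  define tup where "tup a b = a # replicate (ar R - 1) b" for a b :: nat
  have finT: "finite T" using T by auto
  have TU: "T \<subseteq> {1..n}" and moved: "\<And>a. a \<in> T \<Longrightarrow> g a \<noteq> a" unfolding T by auto
  obtain T0 where T0: "T0 \<subseteq> T" "T0 \<inter> g ` T0 = {}" "card T \<le> 3 * card T0"
    using large_subset_disjoint_from_image[OF finT bij_betw_imp_inj_on[OF g] TU moved] by metis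
  have TY: "T0 \<subseteq> Y" using T0 unfolding T Y_def by auto
  have tup_inj: "tup a b = tup a' b' \<longleftrightarrow> a = a' \<and> b = b'" for a b a' b'
    using R unfolding tup_def by auto
  have tup_set: "set (tup a b) = {a, b}" for a b using R unfolding tup_def by auto
  have tup_length: "length (tup a b) = ar R" for a b using R unfolding tup_def by simp
  have tup_map: "map h (tup a b) = tup (h a) (h b)" for h a b unfolding tup_def by simp
  have atom: "(R, tup a b) \<in> atoms" if "a \<in> Y" "b \<in> Y" for a b
    using that unfolding atoms_def Y_def by (auto simp: tup_set tup_length)
  \<comment> \<open>Tuples avoiding \<open>X\<close> are fixed by \<open>K\<close>, so each is a
    coin of its own.\<close>
  have orb: "orb (R, tup a b) = {(R, tup a b)}" if "a \<in> Y" "b \<in> Y" for a b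
  proof -
    have "map p (tup a b) = tup a b" if "p \<in> K" for p
      unfolding tup_map using K_outside[OF that] \<open>a \<in> Y\<close> \<open>b \<in> Y\<close> by (simp add: Y_def)
    then have "orb (R, tup a b) \<subseteq> {(R, tup a b)}" unfolding orb_def by auto
    then show ?thesis using orb_refl by blast
  qed
  define P where "P = (\<lambda>(a, b). orb (R, tup a b)) ` (T0 \<times> Y)"
  have "inj_on (\<lambda>(a, b). orb (R, tup a b)) (T0 \<times> Y)"
    using TY by (intro inj_onI) (auto simp: orb tup_inj subset_iff)
  then have cardP: "card P = card T0 * card Y"
    unfolding P_def by (simp add: card_image card_cartesian_product)
  have Psub: "P \<subseteq> orbs" unfolding P_def orbs_def using atom TY by auto
  have determined: "code M \<inter> P \<subseteq> code N"
    if M: "M \<in> struct_class" "g \<in> Aut ar M" and N: "N \<in> struct_class" "g \<in> Aut ar N"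
      and eq: "code M - P = code N - P" for M N
  proof
    fix c assume c: "c \<in> code M \<inter> P"
    then obtain a b where ab: "a \<in> T0" "b \<in> Y" "c = orb (R, tup a b)" unfolding P_def by auto
    have aY: "a \<in> Y" using ab TY by auto
    have img: "tup a b \<in> rel S R \<longleftrightarrow> tup (g a) (g b) \<in> rel S R"
      if "S \<in> struct_class" "g \<in> Aut ar S" for S
      using that aY ab struct_classD(1)[OF that(1)] tup_length[of a b] tup_set[of a b]
      unfolding Aut_def embedding_def Y_def by (simp add: tup_map[symmetric])
    have "tup a b \<in> rel M R" using c ab orb_mem_code_iff[OF M(1) atom[OF aY ab(2)]] by auto
    then have 1: "tup (g a) (g b) \<in> rel M R" using img[OF M] by simp
    have "tup (g a) (g b) \<in> rel N R"
    \<comment> \<open>\<open>g\<close> may send both entries into \<open>X\<close>; then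
      \<open>B\<close> decides the image tuple, equally for \<open>M\<close> and
      \<open>N\<close>.\<close>
    proof (cases "set (tup (g a) (g b)) \<subseteq> X")
      case True
      then show ?thesis using 1 struct_classD(2)[OF M(1)] struct_classD(2)[OF N(1)] by blast
    next
      case False
      then have at: "(R, tup (g a) (g b)) \<in> atoms"
        using struct_classD(4)[OF M(1) 1] unfolding atoms_def by auto
      have "orb (R, tup (g a) (g b)) \<notin> P"
      proof
        assume "orb (R, tup (g a) (g b)) \<in> P"
        then obtain a' b' where *: "a' \<in> T0" "b' \<in> Y" "orb (R, tup (g a) (g b)) = orb (R, tup a' b')"
          unfolding P_def by auto
        have "(R, tup (g a) (g b)) \<in> orb (R, tup a' b')"
          using orb_refl[of "(R, tup (g a) (g b))"] unfolding *(3) .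
        then have "tup (g a) (g b) = tup a' b'"
          unfolding orb[OF subsetD[OF TY *(1)] *(2)] by simp
        then have "g a = a'" unfolding tup_inj by simp
        then show False using *(1) ab(1) T0(2) by blast
      qed
      then show ?thesis
        using orb_mem_code_iff[OF M(1) at] orb_mem_code_iff[OF N(1) at] 1 eq by blast
    qed
    then show "c \<in> code N" using ab orb_mem_code_iff[OF N(1) atom[OF aY ab(2)]] img[OF N] by simp
  qed
  have "card {M \<in> struct_class. g \<in> Aut ar M} \<le> card (Pow (orbs - P))"
  proof (rule card_inj_on_le)
    show "inj_on (\<lambda>M. code M - P) {M \<in> struct_class. g \<in> Aut ar M}"
    proof (rule inj_onI)
      fix M N assume M: "M \<in> {M \<in> struct_class. g \<in> Aut ar M}" and N: "N \<in> {M \<in> struct_class. g \<in> Aut ar M}"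
        and eq: "code M - P = code N - P"
      have "code M = code N" using determined[of M N] determined[of N M] M N eq by blast
      then show "M = N" using code_inj M N by (simp add: inj_on_eq_iff)
    qed
    show "(\<lambda>M. code M - P) ` {M \<in> struct_class. g \<in> Aut ar M} \<subseteq> Pow (orbs - P)"
      using code_subset by blast
  qed (simp add: finite_orbs)
  also have "\<dots> = 2 ^ (card orbs - card P)"
    using finite_orbs Psub by (simp add: card_Pow card_Diff_subset finite_subset)
  finally have "real (card {M \<in> struct_class. g \<in> Aut ar M}) \<le> real (2 ^ (card orbs - card P))"
    by (rule of_nat_mono)
  also have "\<dots> = 2 ^ card orbs * 2 powr (- real (card P))"
    using card_mono[OF finite_orbs Psub]
    by (simp add: powr_minus powr_realpow field_simps flip: power_add)
  also have "2 powr (- real (card P)) \<le> 2 powr (- (real n - real (card X)) / 3 * real (card T))"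
  proof -
    have "card Y = n - card X" "card X \<le> n"
      using X_subset finite_subset[OF X_subset] card_mono[OF _ X_subset] by (auto simp: Y_def card_Diff_subset)
    then have "real (card P) = real (card T0) * (real n - real (card X))" "0 \<le> real n - real (card X)"
      using cardP by (auto simp: of_nat_diff)
    moreover have "real (card T) \<le> 3 * real (card T0)" using T0(3) by linarith
    ultimately have "real (card T) * (real n - real (card X)) \<le> 3 * real (card P)"
      by (metis mult.assoc mult_right_mono)
    then show ?thesis by (intro powr_mono) (auto simp: field_simps)
  qed
  also have "\<dots> = (2 powr (- (real n - real (card X)) / 3)) ^ card T"
    by (subst powr_powr[symmetric], rule powr_realpow) simp
  finally show ?thesis by (simp add: card_struct_class mult.commute)
qed

text \<open>Such a \<open>g\<close> is the identity off \<open>T \<union> X\<close>, hence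
  determined by its values there. \<open>X\<close> contributes because points of \<open>X\<close>
  may be moved in any way.\<close>

lemma card_permutations_by_support:
  assumes "T \<subseteq> {1..n} - X"
  shows "finite {g \<in> Bij {1..n}. {a \<in> {1..n} - X. g a \<noteq> a} = T}" (is "finite ?G")
    and "card {g \<in> Bij {1..n}. {a \<in> {1..n} - X. g a \<noteq> a} = T} \<le> n ^ (card T + card X)"
proof -
  let ?E = "(T \<union> X) \<rightarrow>\<^sub>E {1..n}"
  have fin: "finite T" "finite X" using assms X_subset finite_subset by blast+
  then have finE: "finite ?E" by (intro finite_PiE) auto
  have inj: "inj_on (\<lambda>g. restrict g (T \<union> X)) ?G"
  proof (rule inj_onI)
    fix g h assume g: "g \<in> ?G" and h: "h \<in> ?G" and eq: "restrict g (T \<union> X) = restrict h (T \<union> X)"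
    have gT: "{a \<in> {1..n} - X. g a \<noteq> a} = T" and hT: "{a \<in> {1..n} - X. h a \<noteq> a} = T"
      using g h by simp_all
    have gh: "g a = h a" if "a \<in> {1..n}" for a
    proof (cases "a \<in> T \<union> X")
      case True
      then show ?thesis using fun_cong[OF eq, of a] by simp
    next
      case False
      then have "g a = a" "h a = a" using that gT hT by blast+
      then show ?thesis by simp
    qed
    have "g \<in> extensional {1..n}" "h \<in> extensional {1..n}" using g h by (simp_all add: Bij_def)
    then show "g = h" using gh by (rule extensionalityI)
  qed
  have im: "(\<lambda>g. restrict g (T \<union> X)) ` ?G \<subseteq> ?E"
  proof clarify
    fix g assume "g \<in> Bij {1..n}" "T = {a \<in> {1..n} - X. g a \<noteq> a}"
    then have "bij_betw g {1..n} {1..n}" by (simp add: Bij_def)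
    then have "g a \<in> {1..n}" if "a \<in> T \<union> X" for a
      using that assms X_subset by (meson DiffD1 UnE bij_betwE subsetD)
    then show "restrict g ({a \<in> {1..n} - X. g a \<noteq> a} \<union> X) \<in> ({a \<in> {1..n} - X. g a \<noteq> a} \<union> X) \<rightarrow>\<^sub>E {1..n}"
      using \<open>T = _\<close> by (simp add: restrict_PiE_iff)
  qed
  show "finite ?G" using inj_on_finite[OF inj im finE] .
  have "card ?G \<le> card ?E" using inj im finE by (rule card_inj_on_le)
  also have "\<dots> = n ^ (card T + card X)"
    using fin assms by (simp add: card_PiE) (subst card_Un_disjoint; auto)
  finally show "card ?G \<le> n ^ (card T + card X)" .
qed

text \<open>Union bound, first over the nonempty set \<open>T\<close> of points moved outside
  \<open>X\<close>, then over the permutations with this \<open>T\<close>. The aim is a summand of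
  the form \<open>y ^ card T\<close>, as required by
  \<open>sum_power_card_nonempty_le\<close>.\<close>

lemma card_moving_outside:
  assumes R: "2 \<le> ar R"
  shows "real (card {M \<in> struct_class. \<exists>g\<in>Aut ar M. \<exists>z\<in>{1..n} - X. g z \<noteq> z})
    \<le> (exp (real n * (real n ^ (card X + 1) * 2 powr (- (real n - real (card X)) / 3))) - 1) * card struct_class"
proof -
  let ?Y = "{1..n} - X" and ?r = "2 powr (- (real n - real (card X)) / 3)"
  let ?C = "real (card struct_class)"
  let ?G = "\<lambda>T. {g \<in> Bij {1..n}. {a \<in> ?Y. g a \<noteq> a} = T}"
  let ?bad = "\<lambda>g. {M \<in> struct_class. g \<in> Aut ar M}"
  let ?Ts = "Pow ?Y - {{}}"
  have "{M \<in> struct_class. \<exists>g\<in>Aut ar M. \<exists>z\<in>?Y. g z \<noteq> z} \<subseteq> (\<Union>T\<in>?Ts. \<Union>g\<in>?G T. ?bad g)"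
  proof clarify
    fix M g z assume M: "M \<in> struct_class" "g \<in> Aut ar M" "z \<in> {1..n}" "z \<notin> X" "g z \<noteq> z"
    have "g \<in> ?G {a \<in> ?Y. g a \<noteq> a}"
      using M(1,2) struct_classD(1) by (auto simp: Aut_def)
    moreover have "{a \<in> ?Y. g a \<noteq> a} \<in> ?Ts" using M by auto
    ultimately show "M \<in> (\<Union>T\<in>?Ts. \<Union>g\<in>?G T. ?bad g)" using M(1,2) by blast
  qed
  then have "card {M \<in> struct_class. \<exists>g\<in>Aut ar M. \<exists>z\<in>?Y. g z \<noteq> z} \<le> card (\<Union>T\<in>?Ts. \<Union>g\<in>?G T. ?bad g)"
    by (rule card_mono[rotated]) (rule finite_subset[OF _ finite_struct_class], auto)
  also have "\<dots> \<le> (\<Sum>T\<in>?Ts. \<Sum>g\<in>?G T. card (?bad g))"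
    by (rule order_trans[OF card_UN_le], simp, rule sum_mono, rule card_UN_le,
        rule card_permutations_by_support) auto
  finally have "real (card {M \<in> struct_class. \<exists>g\<in>Aut ar M. \<exists>z\<in>?Y. g z \<noteq> z})
      \<le> real (\<Sum>T\<in>?Ts. \<Sum>g\<in>?G T. card (?bad g))" by (rule of_nat_mono)
  also have "\<dots> = (\<Sum>T\<in>?Ts. \<Sum>g\<in>?G T. real (card (?bad g)))" by simp
  also have "\<dots> \<le> (\<Sum>T\<in>?Ts. \<Sum>g\<in>?G T. ?r ^ card T * ?C)"
    by (intro sum_mono card_with_automorphism[OF R]) auto
  also have "\<dots> \<le> (\<Sum>T\<in>?Ts. (real n ^ (card X + 1) * ?r) ^ card T * ?C)"
  proof (rule sum_mono)
    fix T assume T: "T \<in> ?Ts"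
    then have fin: "finite T" "T \<noteq> {}" "T \<subseteq> ?Y" by (auto intro: finite_subset)
    then have "card T \<ge> 1" by (simp add: Suc_leI card_gt_0_iff)
    moreover have "n \<ge> 1" using fin by auto
    \<comment> \<open>As \<open>card T \<ge> 1\<close>, the summand \<open>card X\<close> of the
      exponent is absorbed into a multiple of \<open>card T\<close>.\<close>
    ultimately have "n ^ (card T + card X) \<le> n ^ ((card X + 1) * card T)"
      by (intro power_increasing) (auto simp: algebra_simps)
    with card_permutations_by_support(2)[OF fin(3)]
    have "card (?G T) \<le> n ^ ((card X + 1) * card T)" by (rule order_trans)
    then have "real (card (?G T)) \<le> real (n ^ ((card X + 1) * card T))" by (rule of_nat_mono)
    then have "real (card (?G T)) \<le> (real n ^ (card X + 1)) ^ card T"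
      by (simp only: power_mult of_nat_power)
    then have "real (card (?G T)) * (?r ^ card T * ?C) \<le> (real n ^ (card X + 1)) ^ card T * (?r ^ card T * ?C)"
      by (rule mult_right_mono) auto
    then show "(\<Sum>g\<in>?G T. ?r ^ card T * ?C) \<le> (real n ^ (card X + 1) * ?r) ^ card T * ?C"
      by (simp only: sum_constant power_mult_distrib mult.assoc)
  qed
  also have "\<dots> = (\<Sum>T\<in>?Ts. (real n ^ (card X + 1) * ?r) ^ card T) * ?C"
    by (rule sum_distrib_right[symmetric])
  also have "\<dots> \<le> (exp (real (card ?Y) * (real n ^ (card X + 1) * ?r)) - 1) * ?C"
    by (intro mult_right_mono sum_power_card_nonempty_le) auto
  also have "\<dots> \<le> (exp (real n * (real n ^ (card X + 1) * ?r)) - 1) * ?C"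
  proof (intro mult_right_mono diff_right_mono)
    have "card ?Y \<le> n" using card_mono[of "{1..n}" ?Y] by auto
    then show "exp (real (card ?Y) * (real n ^ (card X + 1) * ?r)) \<le> exp (real n * (real n ^ (card X + 1) * ?r))"
      by (simp add: mult_right_mono)
  qed auto
  finally show ?thesis .
qed

end

section \<open>Structures with prescribed support\<close>

lemma Aut_subgroup: "subgroup (Aut ar M) (BijGroup (universe M))"
proof (rule group.subgroupI[OF group_BijGroup])
  let ?U = "universe M"
  show "Aut ar M \<subseteq> carrier (BijGroup ?U)" by (auto simp: Aut_def BijGroup_def)
  have "map (\<lambda>x\<in>?U. x) xs = xs" if "set xs \<subseteq> ?U" for xs
    using that by (intro map_idI) auto
  then have "(\<lambda>x\<in>?U. x) \<in> Aut ar M"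
    by (auto simp: Aut_def embedding_def id_Bij inj_on_def)
  then show "Aut ar M \<noteq> {}" by auto
next
  let ?U = "universe M"
  fix g assume g: "g \<in> Aut ar M"
  then have gB: "g \<in> Bij ?U" and bij: "bij_betw g ?U ?U" and emb: "embedding ar M M g"
    by (auto simp: Aut_def Bij_def)
  let ?g = "\<lambda>x\<in>?U. inv_into ?U g x"
  have B: "?g \<in> Bij ?U" using restrict_inv_into_Bij[OF gB] .
  then have B': "bij_betw ?g ?U ?U" by (simp add: Bij_def)
  have inU: "?g x \<in> ?U" if "x \<in> ?U" for x using B' that by (rule bij_betw_apply)
  have "xs \<in> rel M R \<longleftrightarrow> map ?g xs \<in> rel M R" if xs: "length xs = ar R" "set xs \<subseteq> ?U" for R xs
  proof -
    have "map g (map ?g xs) = xs"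
      using xs bij bij_betw_inv_into_right[OF bij] by (auto intro!: map_idI)
    moreover have "length (map ?g xs) = ar R" "set (map ?g xs) \<subseteq> ?U" using xs inU by auto
    ultimately show ?thesis using emb unfolding embedding_def by metis
  qed
  then have "embedding ar M M ?g"
    unfolding embedding_def using B' bij_betw_imp_inj_on[OF B'] bij_betw_imp_surj_on[OF B'] by blast
  then have "?g \<in> Aut ar M" using B by (simp add: Aut_def)
  then show "inv\<^bsub>BijGroup ?U\<^esub> g \<in> Aut ar M" by (simp only: inv_BijGroup[OF gB])
next
  let ?U = "universe M"
  fix g h assume g: "g \<in> Aut ar M" and h: "h \<in> Aut ar M"
  then have B: "g \<in> Bij ?U" "h \<in> Bij ?U" and emb: "embedding ar M M g" "embedding ar M M h"
    by (auto simp: Aut_def)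
  have C: "compose ?U g h \<in> Bij ?U" using compose_Bij[OF B] .
  then have C': "bij_betw (compose ?U g h) ?U ?U" by (simp add: Bij_def)
  have "xs \<in> rel M R \<longleftrightarrow> map (compose ?U g h) xs \<in> rel M R"
    if xs: "length xs = ar R" "set xs \<subseteq> ?U" for R xs
  proof -
    have "map (compose ?U g h) xs = map g (map h xs)"
      using xs by (auto simp: compose_def)
    moreover have "length (map h xs) = ar R" "set (map h xs) \<subseteq> ?U"
      using xs emb(2) unfolding embedding_def by auto
    ultimately show ?thesis using emb xs unfolding embedding_def by metis
  qed
  then have "embedding ar M M (compose ?U g h)"
    unfolding embedding_def using bij_betw_imp_inj_on[OF C'] bij_betw_imp_surj_on[OF C'] by blast
  then have "compose ?U g h \<in> Aut ar M" using C by (simp add: Aut_def)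
  then show "g \<otimes>\<^bsub>BijGroup ?U\<^esub> h \<in> Aut ar M" using B by (simp add: BijGroup_def)
qed

text \<open>\<open>K\<close> is only a set of permutations here, so group laws for
  \<open>perm_group X K\<close> cannot be invoked. Uniqueness of the inverse is inherited from
  \<open>BijGroup X\<close>.\<close>

lemma perm_group_inv:
  assumes "K \<subseteq> Bij X" "x \<in> K" "y \<in> K" "compose X x y = (\<lambda>z\<in>X. z)" "compose X y x = (\<lambda>z\<in>X. z)"
  shows "inv\<^bsub>perm_group X K\<^esub> x = y"
proof -
  have B: "x \<in> Bij X" "y \<in> Bij X" using assms by auto
  have uniq: "z = y" if z: "z \<in> Bij X" "z \<otimes>\<^bsub>BijGroup X\<^esub> x = \<one>\<^bsub>BijGroup X\<^esub>" for z
  proof -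
    have "inv\<^bsub>BijGroup X\<^esub> x = z"
      using z B by (intro group.inv_equality[OF group_BijGroup]) (auto simp: BijGroup_def)
    moreover have "inv\<^bsub>BijGroup X\<^esub> x = y"
      using assms B by (intro group.inv_equality[OF group_BijGroup]) (auto simp: BijGroup_def)
    ultimately show ?thesis by simp
  qed
  have "(THE z. z \<in> K \<and> x \<otimes>\<^bsub>BijGroup X\<^esub> z = \<one>\<^bsub>BijGroup X\<^esub> \<and> z \<otimes>\<^bsub>BijGroup X\<^esub> x = \<one>\<^bsub>BijGroup X\<^esub>) = y"
  proof (rule the_equality)
    show "y \<in> K \<and> x \<otimes>\<^bsub>BijGroup X\<^esub> y = \<one>\<^bsub>BijGroup X\<^esub> \<and> y \<otimes>\<^bsub>BijGroup X\<^esub> x = \<one>\<^bsub>BijGroup X\<^esub>"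
      using assms B by (simp add: BijGroup_def)
  qed (use uniq assms(1) in blast)
  then show ?thesis by (simp add: m_inv_def perm_group_def)
qed

lemma Spt_star_fixed: "g \<in> Aut ar M \<Longrightarrow> x \<in> universe M \<Longrightarrow> x \<notin> Spt_star ar M \<Longrightarrow> g x = x"
  unfolding Spt_star_def by auto

text \<open>Automorphisms preserve the support: if \<open>g x\<close> were fixed by all of them,
  then \<open>g (g x) = g x\<close>, and \<open>g x = x\<close> by injectivity. Finiteness then
  gives surjectivity.\<close>

lemma restrict_group_Spt_star_subset:
  assumes "finite (universe M)"
  shows "restrict_group (Aut ar M) (Spt_star ar M) \<subseteq> Bij (Spt_star ar M)"
proof
  fix k assume "k \<in> restrict_group (Aut ar M) (Spt_star ar M)"
  then obtain g where g: "g \<in> Aut ar M" "k = restrict g (Spt_star ar M)"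
    unfolding restrict_group_def by auto
  let ?S = "Spt_star ar M"
  have S: "?S \<subseteq> universe M" unfolding Spt_star_def by auto
  have bij: "bij_betw g (universe M) (universe M)" using Aut_bij[OF g(1)] .
  then have inj: "inj_on g (universe M)" by (rule bij_betw_imp_inj_on)
  have "g x \<in> ?S" if x: "x \<in> ?S" for x
  proof (rule ccontr)
    assume "g x \<notin> ?S"
    moreover have U: "x \<in> universe M" "g x \<in> universe M" using x S bij by (auto dest: bij_betw_apply)
    ultimately have "g (g x) = g x" using Spt_star_fixed[OF g(1)] by blast
    then have "g x = x" using inj U by (simp add: inj_on_eq_iff)
    then show False using x \<open>g x \<notin> ?S\<close> by simp
  qed
  then have "g ` ?S \<subseteq> ?S" by auto
  moreover have "inj_on g ?S" using inj S by (rule inj_on_subset)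
  moreover have "finite ?S" using assms S by (rule finite_subset[rotated])
  ultimately have "bij_betw g ?S ?S" by (simp add: bij_betw_def endo_inj_surj)
  then show "k \<in> Bij ?S" unfolding g(2) Bij_def by (simp add: bij_betw_restrict_eq)
qed

lemma (in invariant_class) map_in_rel_iff:
  assumes "M \<in> struct_class" "p \<in> K"
  shows "map p xs \<in> rel M R \<longleftrightarrow> xs \<in> rel M R"
proof
  assume "map p xs \<in> rel M R"
  from struct_classD(3)[OF assms(1) K_inv[OF assms(2)] this]
  show "xs \<in> rel M R" using permutes_inverses(2)[OF K_permutes[OF assms(2)]] by (simp add: comp_def)
qed (rule struct_classD(3)[OF assms])

lemma (in invariant_class) restrict_in_Aut:
  assumes "M \<in> struct_class" "p \<in> K"
  shows "restrict p {1..n} \<in> Aut ar M"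
proof -
  have U: "universe M = {1..n}" using struct_classD(1)[OF assms(1)] .
  have "p permutes {1..n}" using permutes_subset[OF K_permutes[OF assms(2)] X_subset] .
  then have bij: "bij_betw p {1..n} {1..n}" by (rule permutes_imp_bij)
  have "map (restrict p {1..n}) xs = map p xs" if "set xs \<subseteq> {1..n}" for xs
    using that by auto
  then have "xs \<in> rel M R \<longleftrightarrow> map (restrict p {1..n}) xs \<in> rel M R" if "set xs \<subseteq> {1..n}" for xs R
    using that map_in_rel_iff[OF assms, of xs R] by (simp only:)
  moreover have "inj_on (restrict p {1..n}) {1..n}" "restrict p {1..n} ` {1..n} \<subseteq> {1..n}"
    using bij by (auto simp: bij_betw_def inj_on_restrict_eq)
  ultimately have "embedding ar M M (restrict p {1..n})"
    unfolding embedding_def U by blast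
  then show ?thesis using bij unfolding Aut_def U Bij_def by (simp add: bij_betw_restrict_eq)
qed

section \<open>The classes C(f) and their relation to S_n(A,H)\<close>

locale supported_structure =
  fixes ar :: "'r::finite \<Rightarrow> nat" and A :: "('r, nat) rstruct" and H :: "(nat \<Rightarrow> nat) set"
  assumes A_structure: "is_structure ar A"
    and A_universe: "finite (universe A)" "universe A \<noteq> {}"
    and H_subgroup: "subgroup H (perm_group (universe A) (Aut ar A))"
    and H_moves: "no_fixed_point (universe A) H"
    and binary: "\<exists>R. 2 \<le> ar R"
begin

abbreviation I :: "nat set" where "I \<equiv> universe A"

lemma H_subgroup_BijGroup: "subgroup H (BijGroup I)"
  using group.incl_subgroup[OF group_BijGroup Aut_subgroup] H_subgroup unfolding perm_group_def .

lemma H_Aut: "h \<in> H \<Longrightarrow> h \<in> Aut ar A"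
  using subgroup.subset[OF H_subgroup] by (auto simp: perm_group_def)

lemma H_Bij: "h \<in> H \<Longrightarrow> h \<in> Bij I"
  using H_Aut by (auto simp: Aut_def)

lemma H_bij: "h \<in> H \<Longrightarrow> bij_betw h I I"
  using H_Aut Aut_bij by blast

lemma H_image: "h \<in> H \<Longrightarrow> i \<in> I \<Longrightarrow> h i \<in> I"
  using H_bij by (rule bij_betw_apply)

lemma H_id: "(\<lambda>x\<in>I. x) \<in> H"
  using subgroup.one_closed[OF H_subgroup_BijGroup] by (simp add: BijGroup_def)

lemma H_compose: "g \<in> H \<Longrightarrow> h \<in> H \<Longrightarrow> compose I g h \<in> H"
  using subgroup.m_closed[OF H_subgroup_BijGroup] H_Bij by (simp add: BijGroup_def)

lemma H_inv: "h \<in> H \<Longrightarrow> (\<lambda>x\<in>I. inv_into I h x) \<in> H"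
  using subgroup.m_inv_closed[OF H_subgroup_BijGroup] inv_BijGroup[OF H_Bij] by metis

text \<open>Extensional functions, so that there are finitely many and each embedding is counted
  once.\<close>

definition injections :: "nat \<Rightarrow> (nat \<Rightarrow> nat) set" where
  "injections n = {f \<in> I \<rightarrow>\<^sub>E {1..n}. inj_on f I}"

text \<open>The class C(f).\<close>

definition embedded_class :: "nat \<Rightarrow> (nat \<Rightarrow> nat) \<Rightarrow> ('r, nat) rstruct set" where
  "embedded_class n f = invariant_class.struct_class ar (f ` I) (\<lambda>R. map f ` rel A R) (conj_ext f I ` H) n"

lemma conj_ext_compose:
  assumes "inj_on f I" "h \<in> H"
  shows "conj_ext f I g \<circ> conj_ext f I h = conj_ext f I (compose I g h)"
proof
  fix y
  show "(conj_ext f I g \<circ> conj_ext f I h) y = conj_ext f I (compose I g h) y"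
  proof (cases "y \<in> f ` I")
    case True
    then obtain i where "i \<in> I" "y = f i" by auto
    then show ?thesis using assms H_image by (simp add: compose_def)
  qed simp
qed

lemma conj_ext_id: "inj_on f I \<Longrightarrow> conj_ext f I (\<lambda>x\<in>I. x) = id"
  by (rule ext) (auto simp: conj_ext_def inv_into_into f_inv_into_f)

lemma conj_ext_inverse:
  assumes "inj_on f I" "h \<in> H"
  shows "conj_ext f I (\<lambda>x\<in>I. inv_into I h x) (conj_ext f I h y) = y"
    and "conj_ext f I h (conj_ext f I (\<lambda>x\<in>I. inv_into I h x) y) = y"
proof -
  let ?h = "\<lambda>x\<in>I. inv_into I h x"
  have "compose I ?h h = (\<lambda>x\<in>I. x)" "compose I h ?h = (\<lambda>x\<in>I. x)"
    using H_bij[OF assms(2)] H_image[OF assms(2)] bij_betw_inv_into_left[OF H_bij[OF assms(2)]]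
      bij_betw_inv_into_right[OF H_bij[OF assms(2)]]
    by (auto simp: compose_def fun_eq_iff)
  then have "conj_ext f I ?h \<circ> conj_ext f I h = id" "conj_ext f I h \<circ> conj_ext f I ?h = id"
    using assms conj_ext_compose H_inv conj_ext_id by metis+
  then show "conj_ext f I ?h (conj_ext f I h y) = y" "conj_ext f I h (conj_ext f I ?h y) = y"
    by (metis comp_apply id_apply)+
qed

lemma rel_A: "xs \<in> rel A R \<Longrightarrow> length xs = ar R \<and> set xs \<subseteq> I"
  using A_structure unfolding is_structure_def by blast

lemma invariant_class_conj_ext:
  assumes "f \<in> injections n"
  shows "invariant_class ar (f ` I) (\<lambda>R. map f ` rel A R) (conj_ext f I ` H) n"
proof
  have inj: "inj_on f I" and fI: "f ` I \<subseteq> {1..n}" using assms unfolding injections_def by auto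
  show "f ` I \<subseteq> {1..n}" by (rule fI)
  show "length xs = ar R \<and> set xs \<subseteq> f ` I" if "xs \<in> map f ` rel A R" for xs R
    using that rel_A by fastforce
  show "map p xs \<in> map f ` rel A R" if p: "p \<in> conj_ext f I ` H" and xs: "xs \<in> map f ` rel A R" for p xs R
  proof -
    obtain h ys where h: "h \<in> H" "p = conj_ext f I h" and ys: "ys \<in> rel A R" "xs = map f ys"
      using p xs by auto
    have "map h ys \<in> rel A R"
      using H_Aut[OF h(1)] rel_A[OF ys(1)] ys(1) unfolding Aut_def embedding_def by blast
    moreover have "map p xs = map f (map h ys)"
      using rel_A[OF ys(1)] inj unfolding ys h by auto
    ultimately show ?thesis by blast
  qed
  show "p permutes f ` I" if "p \<in> conj_ext f I ` H" for p
    using that conj_ext_permutes[OF inj] H_bij by auto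
  show "id \<in> conj_ext f I ` H" using conj_ext_id[OF inj] H_id by (metis imageI)
  show "p \<circ> q \<in> conj_ext f I ` H" if "p \<in> conj_ext f I ` H" "q \<in> conj_ext f I ` H" for p q
    using that conj_ext_compose[OF inj] H_compose by auto
  show "inv_into UNIV p \<in> conj_ext f I ` H" if p: "p \<in> conj_ext f I ` H" for p
  proof -
    obtain h where h: "h \<in> H" "p = conj_ext f I h" using p by auto
    have "inv_into UNIV p = conj_ext f I (\<lambda>x\<in>I. inv_into I h x)"
      unfolding h(2) by (rule inv_equality) (rule conj_ext_inverse[OF inj h(1)])+
    then show ?thesis using H_inv[OF h(1)] by blast
  qed
qed

lemma embedded_class_iff:
  assumes "f \<in> injections n"
  shows "M \<in> embedded_class n f \<longleftrightarrow> M \<in> structs_n ar n \<and>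
    (\<forall>R xs. set xs \<subseteq> f ` I \<longrightarrow> (xs \<in> rel M R \<longleftrightarrow> xs \<in> map f ` rel A R)) \<and>
    (\<forall>h\<in>H. \<forall>R xs. xs \<in> rel M R \<longrightarrow> map (conj_ext f I h) xs \<in> rel M R)"
  unfolding embedded_class_def invariant_class.struct_class_def[OF invariant_class_conj_ext[OF assms]] by simp

lemma embedding_map_rel_iff:
  assumes "inj_on f I" "set xs \<subseteq> I"
  shows "map f xs \<in> map f ` rel A R \<longleftrightarrow> xs \<in> rel A R"
proof
  assume "map f xs \<in> map f ` rel A R"
  then obtain ys where ys: "ys \<in> rel A R" "map f xs = map f ys" by auto
  then have "xs = ys"
    using assms rel_A[OF ys(1)] by (metis inj_on_subset map_inj_on sup.bounded_iff)
  then show "xs \<in> rel A R" using ys by simp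
qed auto

lemma embedded_class_embedding:
  assumes f: "f \<in> injections n" and M: "M \<in> embedded_class n f"
  shows "embedding ar A M f"
proof -
  have inj: "inj_on f I" and fI: "f ` I \<subseteq> {1..n}" using f unfolding injections_def by auto
  have U: "universe M = {1..n}" using M embedded_class_iff[OF f] by (simp add: structs_n_def)
  have "xs \<in> rel A R \<longleftrightarrow> map f xs \<in> rel M R" if xs: "set xs \<subseteq> I" for R xs
  proof -
    have "set (map f xs) \<subseteq> f ` I" using xs by auto
    then have "map f xs \<in> rel M R \<longleftrightarrow> map f xs \<in> map f ` rel A R"
      using M unfolding embedded_class_iff[OF f] by blast
    then show ?thesis using embedding_map_rel_iff[OF inj xs] by simp
  qed
  then show ?thesis using inj fI unfolding embedding_def U by blast
qed

lemma conj_group_eq: "conj_group f I H = (\<lambda>h. restrict (conj_ext f I h) (f ` I)) ` H"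
  unfolding conj_group_def by (intro image_cong refl restrict_ext) (simp add: conj_ext_def)

text \<open>Every point \<open>f i\<close> is moved by an extended conjugate, because some element
  of \<open>H\<close> moves \<open>i\<close>.\<close>

lemma embedded_class_Spt_star:
  assumes f: "f \<in> injections n" and M: "M \<in> embedded_class n f"
    and fixes_outside: "\<And>g z. g \<in> Aut ar M \<Longrightarrow> z \<in> {1..n} - f ` I \<Longrightarrow> g z = z"
  shows "Spt_star ar M = f ` I"
proof
  interpret C: invariant_class ar "f ` I" "\<lambda>R. map f ` rel A R" "conj_ext f I ` H" n
    using invariant_class_conj_ext[OF f] .
  have M': "M \<in> C.struct_class" using M unfolding embedded_class_def .
  have U: "universe M = {1..n}" using C.struct_classD(1)[OF M'] .
  have inj: "inj_on f I" and fI: "f ` I \<subseteq> {1..n}" using f unfolding injections_def by auto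
  show "Spt_star ar M \<subseteq> f ` I"
    using fixes_outside unfolding Spt_star_def U by auto
  show "f ` I \<subseteq> Spt_star ar M"
  proof clarify
    fix i assume i: "i \<in> I"
    then obtain h where h: "h \<in> H" "h i \<noteq> i" using H_moves unfolding no_fixed_point_def by auto
    have "restrict (conj_ext f I h) {1..n} (f i) \<noteq> f i"
      using i h inj fI H_image[OF h(1) i] by (auto simp: inj_on_eq_iff)
    then show "f i \<in> Spt_star ar M"
      using C.restrict_in_Aut[OF M' imageI[OF h(1)]] i fI unfolding Spt_star_def U by blast
  qed
qed

text \<open>Restricting the extended conjugates to the support carries composition and inverses of
  \<open>H\<close> to those of \<open>restrict_group\<close>, so the image of \<open>H\<close> is a
  subgroup.\<close>

lemma embedded_class_subset_structs_n_AH: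
  assumes f: "f \<in> injections n" and M: "M \<in> embedded_class n f" and Spt: "Spt_star ar M = f ` I"
  shows "M \<in> structs_n_AH ar A H n"
proof -
  interpret C: invariant_class ar "f ` I" "\<lambda>R. map f ` rel A R" "conj_ext f I ` H" n
    using invariant_class_conj_ext[OF f] .
  have M': "M \<in> C.struct_class" using M unfolding embedded_class_def .
  have U: "universe M = {1..n}" using C.struct_classD(1)[OF M'] .
  have inj: "inj_on f I" and fI: "f ` I \<subseteq> {1..n}" using f unfolding injections_def by auto
  let ?X = "f ` I" let ?K = "restrict_group (Aut ar M) ?X"
  let ?c = "\<lambda>h. restrict (conj_ext f I h) ?X"
  have KB: "?K \<subseteq> Bij ?X" using restrict_group_Spt_star_subset[of M ar] U Spt by simp
  have cK: "?c h \<in> ?K" if "h \<in> H" for h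
  proof -
    have "?c h = restrict (restrict (conj_ext f I h) {1..n}) ?X"
      using fI by (auto simp: fun_eq_iff restrict_def)
    then show ?thesis
      unfolding restrict_group_def using C.restrict_in_Aut[OF M' imageI[OF that]] by blast
  qed
  have cc: "compose ?X (?c g) (?c h) = ?c (compose I g h)" if "h \<in> H" for g h
  proof
    fix y
    show "compose ?X (?c g) (?c h) y = ?c (compose I g h) y"
    proof (cases "y \<in> ?X")
      case True
      then have "conj_ext f I h y \<in> ?X" using C.K_image that by blast
      then show ?thesis
        using True conj_ext_compose[OF inj that, of g] by (simp add: compose_def) (metis comp_apply)
    qed (simp add: compose_def)
  qed
  have c1: "?c (\<lambda>x\<in>I. x) = (\<lambda>x\<in>?X. x)" using conj_ext_id[OF inj] by (simp add: fun_eq_iff)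
  have inv: "compose I h (\<lambda>x\<in>I. inv_into I h x) = (\<lambda>x\<in>I. x)"
    "compose I (\<lambda>x\<in>I. inv_into I h x) h = (\<lambda>x\<in>I. x)" if "h \<in> H" for h
    using H_image[OF that] bij_betw_inv_into_left[OF H_bij[OF that]]
      bij_betw_inv_into_right[OF H_bij[OF that]]
    by (auto simp: compose_def fun_eq_iff)
  have "subgroup (?c ` H) (perm_group ?X ?K)"
  proof
    show "?c ` H \<subseteq> carrier (perm_group ?X ?K)" using cK by (auto simp: perm_group_def)
    show "x \<otimes>\<^bsub>perm_group ?X ?K\<^esub> y \<in> ?c ` H" if "x \<in> ?c ` H" "y \<in> ?c ` H" for x y
      using that
    proof (elim imageE)
      fix g h assume gh: "g \<in> H" "h \<in> H" "x = ?c g" "y = ?c h"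
      have "?c g \<in> Bij ?X" "?c h \<in> Bij ?X" using cK[OF gh(1)] cK[OF gh(2)] KB by blast+
      then have "?c g \<otimes>\<^bsub>perm_group ?X ?K\<^esub> ?c h = compose ?X (?c g) (?c h)"
        by (simp add: perm_group_def BijGroup_def)
      also have "\<dots> = ?c (compose I g h)" by (rule cc) fact
      finally show ?thesis unfolding gh(3,4) using imageI[OF H_compose[OF gh(1,2)], of ?c] by (simp only:)
    qed
    have "\<one>\<^bsub>perm_group ?X ?K\<^esub> = ?c (\<lambda>x\<in>I. x)"
      unfolding c1 by (simp add: perm_group_def BijGroup_def)
    then show "\<one>\<^bsub>perm_group ?X ?K\<^esub> \<in> ?c ` H" using H_id by blast
    show "inv\<^bsub>perm_group ?X ?K\<^esub> x \<in> ?c ` H" if "x \<in> ?c ` H" for x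
      using that
    proof (elim imageE)
      fix h assume h: "h \<in> H" "x = ?c h"
      let ?h = "\<lambda>x\<in>I. inv_into I h x"
      have "inv\<^bsub>perm_group ?X ?K\<^esub> (?c h) = ?c ?h"
        by (rule perm_group_inv[OF KB cK[OF h(1)] cK[OF H_inv[OF h(1)]]])
          (simp_all only: cc[OF H_inv[OF h(1)]] cc[OF h(1)] inv[OF h(1)] c1)
      then show ?thesis unfolding h(2) using imageI[OF H_inv[OF h(1)], of ?c] by (simp only:)
    qed
  qed
  then have "subgroup (conj_group f I H) (perm_group (Spt_star ar M) (restrict_group (Aut ar M) (Spt_star ar M)))"
    unfolding Spt conj_group_eq .
  moreover have "M \<in> structs_n ar n" using M unfolding embedded_class_iff[OF f] by blast
  ultimately show ?thesis
    unfolding structs_n_AH_def using embedded_class_embedding[OF f M] Spt by blast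
qed

text \<open>A conjugate of an element of \<open>H\<close> is the restriction of some automorphism
  \<open>k\<close> to the support. Off the support \<open>k\<close> is the identity, so
  \<open>k\<close> coincides on the universe with the extension by the identity.\<close>

lemma structs_n_AH_embedded_class:
  assumes "M \<in> structs_n_AH ar A H n"
  obtains f where "f \<in> injections n" "M \<in> embedded_class n f" "Spt_star ar M = f ` I"
proof -
  obtain f0 where M: "M \<in> structs_n ar n" and f0: "embedding ar A M f0" "f0 ` I = Spt_star ar M"
    and sub: "subgroup (conj_group f0 I H) (perm_group (Spt_star ar M) (restrict_group (Aut ar M) (Spt_star ar M)))"
    using assms unfolding structs_n_AH_def by auto
  have U: "universe M = {1..n}" and st: "is_structure ar M" using M by (auto simp: structs_n_def)
  let ?f = "restrict f0 I"
  have inj0: "inj_on f0 I" and "f0 ` I \<subseteq> {1..n}" using f0(1) U unfolding embedding_def by auto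
  then have f: "?f \<in> injections n" unfolding injections_def by (auto simp: inj_on_restrict_eq)
  have inj: "inj_on ?f I" using inj0 by (simp add: inj_on_restrict_eq)
  have im: "?f ` I = f0 ` I" by auto
  have ce: "conj_ext ?f I h x = conj_ext f0 I h x" if h: "h \<in> H" for h x
  proof (cases "x \<in> f0 ` I")
    case True
    then obtain i where i: "i \<in> I" "x = f0 i" by auto
    then have "x = ?f i" by simp
    then show ?thesis using conj_ext_apply[OF inj i(1)] conj_ext_apply[OF inj0 i(1)] i H_image[OF h i(1)] by simp
  next
    case False
    then show ?thesis using im by (metis conj_ext_outside)
  qed
  have "M \<in> embedded_class n ?f"
    unfolding embedded_class_iff[OF f] im
  proof (intro conjI allI impI ballI M)
    fix R xs assume "set xs \<subseteq> f0 ` I"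
    then have "xs \<in> lists (f0 ` I)" by auto
    then obtain ys where ys: "xs = map f0 ys" "set ys \<subseteq> I" unfolding lists_image by auto
    have eq: "map ?f ` rel A R = map f0 ` rel A R"
      using rel_A by (intro image_cong) (auto simp: subset_iff)
    show "(xs \<in> rel M R) = (xs \<in> map ?f ` rel A R)"
    proof (cases "length ys = ar R")
      case True
      then show ?thesis
        using f0(1) ys embedding_map_rel_iff[OF inj0 ys(2)] unfolding embedding_def eq ys(1) by blast
    next
      \<comment> \<open>\<open>embedding\<close> constrains only lists of length
        \<open>ar R\<close>; for other lists both memberships fail.\<close>
      case False
      have "length xs = ar R" if "xs \<in> rel M R" using st that unfolding is_structure_def by blast
      moreover have "length xs = ar R" if "xs \<in> map f0 ` rel A R" using that rel_A by auto
      ultimately show ?thesis using False ys(1) unfolding eq by auto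
    qed
  next
    fix h R xs assume h: "h \<in> H" and xs: "xs \<in> rel M R"
    have "restrict (conj_ext f0 I h) (f0 ` I) \<in> restrict_group (Aut ar M) (Spt_star ar M)"
      using subgroup.subset[OF sub] h unfolding conj_group_eq by (auto simp: perm_group_def)
    then obtain k where k: "k \<in> Aut ar M" "restrict (conj_ext f0 I h) (f0 ` I) = restrict k (f0 ` I)"
      unfolding restrict_group_def f0(2)[symmetric] by auto
    have xsU: "set xs \<subseteq> universe M" "length xs = ar R" using st xs unfolding is_structure_def by auto
    have "conj_ext f0 I h x = k x" if "x \<in> universe M" for x
    proof (cases "x \<in> f0 ` I")
      case True
      then show ?thesis using fun_cong[OF k(2), of x] by simp
    next
      case False
      then show ?thesis using Spt_star_fixed[OF k(1) that] f0(2) by simp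
    qed
    then have "map (conj_ext ?f I h) xs = map k xs" using xsU ce[OF h] by (simp add: subset_iff)
    moreover have "map k xs \<in> rel M R" using k(1) xs xsU unfolding Aut_def embedding_def by blast
    ultimately show "map (conj_ext ?f I h) xs \<in> rel M R" by (simp only:)
  qed
  then show ?thesis using that f f0(2) im by metis
qed

end

section \<open>The zero-one law\<close>

context supported_structure
begin

lemma finite_injections: "finite (injections n)"
  unfolding injections_def using A_universe by (auto intro: finite_PiE finite_subset)

lemma injections_nonempty:
  assumes "card I \<le> n"
  shows "injections n \<noteq> {}"
proof -
  obtain f where f: "inj_on f I" "f ` I \<subseteq> {1..n}"
    using inj_on_iff_card_le[of I "{1..n}"] A_universe assms by auto
  then have "restrict f I \<in> injections n"
    unfolding injections_def by (auto simp: inj_on_restrict_eq)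
  then show ?thesis by auto
qed

lemma finite_embedded_class: "f \<in> injections n \<Longrightarrow> finite (embedded_class n f)"
  unfolding embedded_class_def using invariant_class.finite_struct_class[OF invariant_class_conj_ext] .

lemma embedded_class_nonempty: "f \<in> injections n \<Longrightarrow> 0 < card (embedded_class n f)"
  unfolding embedded_class_def using invariant_class.card_struct_class[OF invariant_class_conj_ext] by simp

definition good :: "nat \<Rightarrow> nat \<Rightarrow> (nat \<Rightarrow> nat) \<Rightarrow> ('r, nat) rstruct set" where
  "good L n f = {M \<in> embedded_class n f. extension_property ar (f ` I) (conj_ext f I ` H) L M \<and> Spt_star ar M = f ` I}"

text \<open>The errors for (1) and (2) together. It depends on the embedding only through
  \<open>card I\<close>, hence is uniform in \<open>f\<close>.\<close>

definition exception_bound :: "nat \<Rightarrow> nat \<Rightarrow> real" where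
  "exception_bound L n =
     (real n + 1) ^ L * 2 ^ pattern_bound ar L *
       (1 - 1 / 2 ^ pattern_bound ar L) ^ (n - L) +
     (exp (real n * (real n ^ (card I + 1) * 2 powr (- (real n - real (card I)) / 3))) - 1)"

lemma exception_bound_nonneg: "0 \<le> exception_bound L n"
  unfolding exception_bound_def by (intro add_nonneg_nonneg) auto

lemma exception_bound_tendsto: "exception_bound L \<longlonglongrightarrow> 0"
  unfolding exception_bound_def
  using tendsto_add[OF extension_error_tendsto support_error_tendsto] by simp

lemma card_not_good:
  assumes f: "f \<in> injections n"
  shows "real (card (embedded_class n f - good L n f)) \<le> exception_bound L n * card (embedded_class n f)"
proof -
  interpret C: invariant_class ar "f ` I" "\<lambda>R. map f ` rel A R" "conj_ext f I ` H" n
    using invariant_class_conj_ext[OF f] .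
  have C: "C.struct_class = embedded_class n f" unfolding embedded_class_def ..
  have cardX: "card (f ` I) = card I" using f unfolding injections_def by (auto simp: card_image)
  let ?E = "{M \<in> C.struct_class. \<not> extension_property ar (f ` I) (conj_ext f I ` H) L M}"
  let ?S = "{M \<in> C.struct_class. \<exists>g\<in>Aut ar M. \<exists>z\<in>{1..n} - f ` I. g z \<noteq> z}"
  obtain R where R: "2 \<le> ar R" using binary by auto
  have "embedded_class n f - good L n f \<subseteq> ?E \<union> ?S"
    using embedded_class_Spt_star[OF f] unfolding good_def C by blast
  then have "card (embedded_class n f - good L n f) \<le> card (?E \<union> ?S)"
    using C.finite_struct_class by (intro card_mono) auto
  also have "\<dots> \<le> card ?E + card ?S" by (rule card_Un_le)
  finally have "real (card (embedded_class n f - good L n f)) \<le> real (card ?E + card ?S)" by (rule of_nat_mono)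
  then have "real (card (embedded_class n f - good L n f)) \<le> real (card ?E) + real (card ?S)" by simp
  also note add_mono[OF C.card_not_extension_property C.card_moving_outside[OF R]]
  finally show ?thesis unfolding exception_bound_def C cardX by (simp only: distrib_right)
qed

lemma good_generic:
  assumes f: "f \<in> injections n" and M: "M \<in> good L n f"
  shows "generic ar I H L f M" "embedding ar A M f"
proof -
  have embedded_class: "M \<in> embedded_class n f" and ext: "extension_property ar (f ` I) (conj_ext f I ` H) L M"
    using M unfolding good_def by auto
  show emb: "embedding ar A M f" using embedded_class_embedding[OF f embedded_class] .
  have "universe M = {1..n}" using embedded_class unfolding embedded_class_iff[OF f] structs_n_def by blast
  then have zero: "0 \<notin> universe M" by simp
  show "generic ar I H L f M"
    unfolding generic_def
  proof (intro conjI)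
    show "inj_on f I" "f ` I \<subseteq> universe M" using emb unfolding embedding_def by simp_all
    show "\<forall>h\<in>H. \<forall>R xs. xs \<in> rel M R \<longrightarrow> map (conj_ext f I h) xs \<in> rel M R"
      using embedded_class unfolding embedded_class_iff[OF f] by (elim conjE)
    show "0 \<notin> universe M" by (rule zero)
    show "extension_property ar (f ` I) (conj_ext f I ` H) L M" by (rule ext)
  qed
qed

lemma finite_structs_n_AH: "finite (structs_n_AH ar A H n)"
proof (rule finite_subset)
  show "structs_n_AH ar A H n \<subseteq> (\<Union>f\<in>injections n. embedded_class n f)"
  proof
    fix M assume "M \<in> structs_n_AH ar A H n"
    then obtain f where "f \<in> injections n" "M \<in> embedded_class n f" by (rule structs_n_AH_embedded_class)
    then show "M \<in> (\<Union>f\<in>injections n. embedded_class n f)" by blast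
  qed
qed (use finite_injections finite_embedded_class in auto)

text \<open>A good structure lies in few classes, since its support is the image of each of their injections.\<close>

lemma sum_card_good:
  "(\<Sum>f\<in>injections n. card (good L n f)) \<le> card I ^ card I * card (structs_n_AH ar A H n)"
proof -
  let ?S = "structs_n_AH ar A H n"
  let ?F = "\<lambda>M. {f \<in> injections n. f ` I = Spt_star ar M}"
  have fin: "finite (good L n f)" if "f \<in> injections n" for f
    using finite_embedded_class[OF that] unfolding good_def by simp
  have F: "card (?F M) \<le> card I ^ card I" for M
  proof (cases "?F M = {}")
    case False
    then obtain f where f: "inj_on f I" "f ` I = Spt_star ar M" unfolding injections_def by auto
    then have c: "card (Spt_star ar M) = card I" "finite (Spt_star ar M)"
      using card_image[OF f(1)] A_universe by auto
    have "?F M \<subseteq> I \<rightarrow>\<^sub>E Spt_star ar M" unfolding injections_def by auto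
    then have "card (?F M) \<le> card (I \<rightarrow>\<^sub>E Spt_star ar M)"
      using A_universe c by (intro card_mono finite_PiE) auto
    also have "\<dots> = card I ^ card I" using A_universe c by (simp add: card_PiE)
    finally show ?thesis .
  next
    case True
    show ?thesis unfolding True by simp
  qed
  have "(\<Sum>f\<in>injections n. card (good L n f)) = card (SIGMA f:injections n. good L n f)"
    using fin finite_injections by (simp add: card_SigmaI)
  also have "\<dots> \<le> card (SIGMA M:?S. ?F M)"
  proof (rule card_inj_on_le)
    show "inj_on prod.swap (SIGMA f:injections n. good L n f)" by simp
    show "prod.swap ` (SIGMA f:injections n. good L n f) \<subseteq> (SIGMA M:?S. ?F M)"
      using embedded_class_subset_structs_n_AH unfolding good_def by auto
    show "finite (SIGMA M:?S. ?F M)"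
      using finite_structs_n_AH finite_injections by (intro finite_SigmaI) auto
  qed
  also have "\<dots> = (\<Sum>M\<in>?S. card (?F M))"
    using finite_structs_n_AH finite_injections by (intro card_SigmaI) auto
  also have "\<dots> \<le> (\<Sum>M\<in>?S. card I ^ card I)" by (intro sum_mono F)
  also have "\<dots> = card I ^ card I * card ?S" by (simp add: mult.commute)
  finally show ?thesis .
qed

text \<open>The classes overlap, so their total size could exceed that of S_n(A,H) by far. But at
  least half of each class is good, and good structures are counted at most
  \<open>card I ^ card I\<close> times.\<close>

lemma sum_card_embedded_class:
  assumes "exception_bound L n \<le> 1 / 2"
  shows "(\<Sum>f\<in>injections n. real (card (embedded_class n f)))
    \<le> 2 * (card I ^ card I * card (structs_n_AH ar A H n))"
proof -
  let ?T = "\<Sum>f\<in>injections n. real (card (embedded_class n f))"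
  have "real (card (embedded_class n f)) \<le> real (card (good L n f)) + 1 / 2 * real (card (embedded_class n f))"
    if f: "f \<in> injections n" for f
  proof -
    have "card (embedded_class n f) \<le> card (good L n f \<union> (embedded_class n f - good L n f))"
      using finite_embedded_class[OF f] by (intro card_mono) (auto simp: good_def)
    also have "\<dots> \<le> card (good L n f) + card (embedded_class n f - good L n f)" by (rule card_Un_le)
    finally have "real (card (embedded_class n f)) \<le> real (card (good L n f)) + real (card (embedded_class n f - good L n f))"
      by linarith
    also have "real (card (embedded_class n f - good L n f)) \<le> 1 / 2 * real (card (embedded_class n f))"
      using order_trans[OF card_not_good[OF f, of L] mult_right_mono[OF assms, of "real (card (embedded_class n f))"]] by simp
    finally show ?thesis by simp
  qed
  then have "?T \<le> (\<Sum>f\<in>injections n. real (card (good L n f)) + 1 / 2 * real (card (embedded_class n f)))"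
    by (rule sum_mono)
  also have "\<dots> = real (\<Sum>f\<in>injections n. card (good L n f)) + 1 / 2 * ?T"
    by (simp add: sum.distrib sum_distrib_left)
  finally have "?T \<le> 2 * real (\<Sum>f\<in>injections n. card (good L n f))" by simp
  also have "\<dots> \<le> 2 * real (card I ^ card I * card (structs_n_AH ar A H n))"
    by (intro mult_left_mono of_nat_mono sum_card_good) simp
  finally show ?thesis by simp
qed

text \<open>An exception lies in some C(f) without being good there, so exceptions are bounded by
  the errors summed over all classes. The total size of the classes is then compared with
  S_n(A,H).\<close>

lemma card_few_exceptions:
  assumes E: "exception_bound L n \<le> 1 / 2"
    and P: "\<And>f M. f \<in> injections n \<Longrightarrow> M \<in> good L n f \<Longrightarrow> \<not> P M"
  shows "real (card {M \<in> structs_n_AH ar A H n. P M})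
    \<le> (2 * card I ^ card I * exception_bound L n) * card (structs_n_AH ar A H n)"
proof -
  let ?V = "{M \<in> structs_n_AH ar A H n. P M}"
  have fin: "finite (\<Union>f\<in>injections n. embedded_class n f - good L n f)"
    using finite_injections finite_embedded_class by auto
  have "?V \<subseteq> (\<Union>f\<in>injections n. embedded_class n f - good L n f)"
  proof
    fix M assume M: "M \<in> ?V"
    then have "M \<in> structs_n_AH ar A H n" by simp
    then obtain f where f: "f \<in> injections n" "M \<in> embedded_class n f" by (rule structs_n_AH_embedded_class)
    then have "M \<notin> good L n f" using P M by blast
    then show "M \<in> (\<Union>f\<in>injections n. embedded_class n f - good L n f)" using f by blast
  qed
  then have "card ?V \<le> card (\<Union>f\<in>injections n. embedded_class n f - good L n f)" using fin by (rule card_mono[rotated])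
  also have "\<dots> \<le> (\<Sum>f\<in>injections n. card (embedded_class n f - good L n f))"
    by (rule card_UN_le[OF finite_injections])
  finally have "real (card ?V) \<le> real (\<Sum>f\<in>injections n. card (embedded_class n f - good L n f))" by (rule of_nat_mono)
  also have "\<dots> = (\<Sum>f\<in>injections n. real (card (embedded_class n f - good L n f)))" by simp
  also have "\<dots> \<le> (\<Sum>f\<in>injections n. exception_bound L n * real (card (embedded_class n f)))"
    by (intro sum_mono card_not_good)
  also have "\<dots> = exception_bound L n * (\<Sum>f\<in>injections n. real (card (embedded_class n f)))"
    by (rule sum_distrib_left[symmetric])
  also have "\<dots> \<le> exception_bound L n * (2 * (card I ^ card I * card (structs_n_AH ar A H n)))"
    by (intro mult_left_mono sum_card_embedded_class[OF E] exception_bound_nonneg)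
  finally show ?thesis by (simp add: algebra_simps)
qed

lemma proportion_exceptions_tendsto:
  assumes P: "\<And>n f M. f \<in> injections n \<Longrightarrow> M \<in> good L n f \<Longrightarrow> \<not> P M"
  shows "(\<lambda>n. real (card {M \<in> structs_n_AH ar A H n. P M}) / real (card (structs_n_AH ar A H n))) \<longlonglongrightarrow> 0"
proof (rule tendsto_sandwich[where f = "\<lambda>_. 0" and h = "\<lambda>n. 2 * card I ^ card I * exception_bound L n"])
  from tendsto_mult_left[OF exception_bound_tendsto, of "real (2 * card I ^ card I)" L]
  show "(\<lambda>n. 2 * card I ^ card I * exception_bound L n) \<longlonglongrightarrow> 0" by simp
  have "eventually (\<lambda>n. exception_bound L n < 1 / 2) sequentially"
    using exception_bound_tendsto by (rule order_tendstoD) simp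
  then show "eventually (\<lambda>n. real (card {M \<in> structs_n_AH ar A H n. P M}) / real (card (structs_n_AH ar A H n))
      \<le> 2 * card I ^ card I * exception_bound L n) sequentially"
  proof eventually_elim
    case (elim n)
    show ?case
    \<comment> \<open>For an empty class the quotient is 0 by the convention for division.\<close>
    proof (cases "card (structs_n_AH ar A H n) = 0")
      case False
      then show ?thesis using card_few_exceptions[of L n P] P elim by (simp add: divide_le_eq)
    qed (simp add: exception_bound_nonneg)
  qed
qed simp_all

text \<open>In an empty class the proportions of a sentence and of its negation are both 0;
  nonemptiness lets the first be written as 1 minus the second. The choice 0 for \<open>L\<close> is
  arbitrary.\<close>

lemma eventually_structs_n_AH_nonempty:
  "eventually (\<lambda>n. 0 < card (structs_n_AH ar A H n)) sequentially"
proof -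
  have "eventually (\<lambda>n. exception_bound 0 n < 1 / 2) sequentially"
    using exception_bound_tendsto by (rule order_tendstoD) simp
  then show ?thesis using eventually_ge_at_top[of "card I"]
  proof eventually_elim
    case (elim n)
    have "0 < (\<Sum>f\<in>injections n. real (card (embedded_class n f)))"
      using injections_nonempty[OF elim(2)] embedded_class_nonempty finite_injections
      by (intro sum_pos) auto
    also have "\<dots> \<le> 2 * (card I ^ card I * card (structs_n_AH ar A H n))"
      using elim by (intro sum_card_embedded_class[of 0]) simp
    finally show ?case by (simp add: zero_less_mult_iff)
  qed
qed

lemma zero_one_law_structs_n_AH: "zero_one_law ar (structs_n_AH ar A H)"
  unfolding zero_one_law_def
proof (intro allI impI)
  fix \<phi> assume \<phi>: "sentence ar \<phi>"
  let ?S = "structs_n_AH ar A H"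
  define L where "L = card I + width \<phi>"
  \<comment> \<open>Since \<open>n\<close> and \<open>n'\<close> may differ, one good model of the
    sentence makes every good structure of every size a model.\<close>
  have agree: "models M \<phi> \<longleftrightarrow> models M' \<phi>"
    if "f \<in> injections n" "M \<in> good L n f" "f' \<in> injections n'" "M' \<in> good L n' f'" for n f M n' f' M'
    using good_generic[OF that(1,2)] good_generic[OF that(3,4)] A_universe H_bij \<phi>
    by (intro generic_models_iff[where A = A and I = I and L = L]) (auto simp: L_def)
  show "(\<lambda>n. proportion (?S n) \<phi>) \<longlonglongrightarrow> 0 \<or> (\<lambda>n. proportion (?S n) \<phi>) \<longlonglongrightarrow> 1"
  proof (cases "\<exists>n f M. f \<in> injections n \<and> M \<in> good L n f \<and> models M \<phi>")
    case False
    then have "(\<lambda>n. proportion (?S n) \<phi>) \<longlonglongrightarrow> 0"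
      unfolding proportion_def by (intro proportion_exceptions_tendsto[of L]) blast
    then show ?thesis ..
  next
    case True
    then have all: "models M \<phi>" if "f \<in> injections n" "M \<in> good L n f" for n f M
      using agree that by blast
    let ?q = "\<lambda>n. real (card {M \<in> ?S n. \<not> models M \<phi>}) / real (card (?S n))"
    have "?q \<longlonglongrightarrow> 0"
      by (rule proportion_exceptions_tendsto[of L]) (use all in blast)
    then have "(\<lambda>n. 1 - ?q n) \<longlonglongrightarrow> 1" using tendsto_diff[OF tendsto_const] by fastforce
    moreover have "eventually (\<lambda>n. 1 - ?q n = proportion (?S n) \<phi>) sequentially"
      using eventually_structs_n_AH_nonempty
    proof eventually_elim
      case (elim n)
      have "card (?S n) = card ({M \<in> ?S n. models M \<phi>} \<union> {M \<in> ?S n. \<not> models M \<phi>})"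
        by (rule arg_cong[of _ _ card]) auto
      also have "\<dots> = card {M \<in> ?S n. models M \<phi>} + card {M \<in> ?S n. \<not> models M \<phi>}"
        using finite_structs_n_AH by (intro card_Un_disjoint) auto
      finally have "real (card (?S n)) = real (card {M \<in> ?S n. models M \<phi>}) + real (card {M \<in> ?S n. \<not> models M \<phi>})"
        by simp
      then show ?case using elim unfolding proportion_def by (simp add: field_simps)
    qed
    ultimately have "(\<lambda>n. proportion (?S n) \<phi>) \<longlonglongrightarrow> 1" by (rule Lim_transform_eventually)
    then show ?thesis ..
  qed
qed

end

theorem theorem6p1:
  fixes ar :: "'r::finite \<Rightarrow> nat"
    and A :: "('r, nat) rstruct"
    and H :: "(nat \<Rightarrow> nat) set"
  assumes "\<And>R. 1 \<le> ar R"
    and "\<exists>R. 2 \<le> ar R"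
    and "A \<in> structs ar"
    and "no_fixed_point (universe A) (Aut ar A)"
    and "subgroup H (perm_group (universe A) (Aut ar A))"
    and "no_fixed_point (universe A) H"
  shows "zero_one_law ar (structs_n_AH ar A H)"
proof -
  obtain n where n: "1 \<le> n" "is_structure ar A" "universe A = {1..n}"
    using assms(3) unfolding structs_def structs_n_def by auto
  then have "supported_structure ar A H"
    using assms by (intro supported_structure.intro) simp_all
  then show ?thesis by (rule supported_structure.zero_one_law_structs_n_AH)
qed

end
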